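(* Let $a_n>0$, $b_n\in\mathbb R$ ($n\ge 0$) satisfy, as $n\to\infty$, $$a_n=n^{\sigma}\bigl(1+\alpha n^{-1}+O(n^{-2})\bigr),\qquad b_n=2\gamma n^{\sigma}\bigl(1+\beta n^{-1}+O(n^{-2})\bigr)$$ with $\alpha,\beta\in\mathbb R$, $|\gamma|=1$ and $\sigma>3/2$. Put $\nu=-\operatorname{sgn}\gamma$, $\tau=2\beta-2\alpha+\sigma$ and $\varrho=\min\{\sigma-3/2,\,1/2\}$. Then, for all $z\in\mathbb C$, the sequence of the orthogonal polynomials $P_n(z)$ with recurrence coefficients $a_n,b_n$ has asymptotics $$P_n(z)=\nu^n n^{-\sigma/2+1/4}\Bigl(\kappa_+(z)e^{-2i\sqrt{|\tau|n}}+\kappa_-(z)e^{2i\sqrt{|\tau|n}}+O(n^{-\varrho})\Bigr),\qquad n\to\infty,$$ if $\tau<0$, and $$P_n(z)=\kappa(z)\,\nu^n n^{-\sigma/2+1/4}e^{2\sqrt{\tau n}}\bigl(1+O(n^{-\varrho})\bigr),\qquad n\to\infty,$$ if $\tau>0$. Here $\kappa_\pm(z)$ and $\kappa(z)$ are some complex constants (depending on $z$ but not on $n$). Both asymptotic relations are uniform in $z$ from compact subsets of the complex plane $\mathbb C$.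
   Context: The polynomials $P_n(z)$ are defined by the recurrence relation $a_{n-1}P_{n-1}(z)+b_nP_n(z)+a_nP_{n+1}(z)=zP_n(z)$ for $n\ge0$, with $P_{-1}(z)=0$, $P_0(z)=1$.
   Formalization: For τ>0 the relative-error relation fails at z where (P_n(z)) is square summable; it is proved for all other z, uniformly on compacts avoiding them, with κ(z)=0 exactly there, and P_n=A_n(κ(z)+O(n^{-ϱ})) is proved uniformly on compacts of C, A_n=ν^n n^{-σ/2+1/4}e^{2√(τn)}. *)

theory Defs
  imports
    "HOL-Analysis.Analysis"
    "HOL-Library.Landau_Symbols"
    "HOL-Computational_Algebra.Polynomial"
begin

text \<open>
  The recurrence \<open>a\<^sub>n\<^sub>-\<^sub>1 P\<^sub>n\<^sub>-\<^sub>1 + b\<^sub>n P\<^sub>n + a\<^sub>n P\<^sub>n\<^sub>+\<^sub>1 = z P\<^sub>n\<close>, \<open>P\<^sub>-\<^sub>1 = 0\<close>, \<open>P\<^sub>0 = 1\<close>, solved for \<open>P\<^sub>n\<^sub>+\<^sub>1\<close>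
  (this requires \<open>a\<^sub>n \<noteq> 0\<close>); the polynomial \<open>[:- b n, 1:]\<close> is \<open>z - b\<^sub>n\<close>.
\<close>

fun orth_poly :: "(nat \<Rightarrow> real) \<Rightarrow> (nat \<Rightarrow> real) \<Rightarrow> nat \<Rightarrow> complex poly" where
  "orth_poly a b 0 = 1"
| "orth_poly a b (Suc 0) = smult (inverse (of_real (a 0))) [:- of_real (b 0), 1:]"
| "orth_poly a b (Suc (Suc n)) =
     smult (inverse (of_real (a (Suc n))))
       ([:- of_real (b (Suc n)), 1:] * orth_poly a b (Suc n)
        - smult (of_real (a n)) (orth_poly a b n))"

lemma orth_poly_recurrence:
  assumes "\<And>n. a n > 0"
  shows "of_real (b 0) * poly (orth_poly a b 0) z + of_real (a 0) * poly (orth_poly a b 1) z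
           = z * poly (orth_poly a b 0) z" (is ?zero)
    and "of_real (a n) * poly (orth_poly a b n) z
           + of_real (b (Suc n)) * poly (orth_poly a b (Suc n)) z
           + of_real (a (Suc n)) * poly (orth_poly a b (Suc (Suc n))) z
           = z * poly (orth_poly a b (Suc n)) z" (is ?step)
proof -
  have nz: "complex_of_real (a k) \<noteq> 0" for k
    using assms[of k] by simp
  show ?zero using nz[of 0] by (simp add: field_simps)
  show ?step using nz[of "Suc n"] by (simp add: field_simps)
qed

text \<open>
  Every solution \<open>u\<close> of \<open>a\<^sub>n\<^sub>-\<^sub>1 u\<^sub>n\<^sub>-\<^sub>1 + b\<^sub>n u\<^sub>n + a\<^sub>n u\<^sub>n\<^sub>+\<^sub>1 = z u\<^sub>n\<close> with \<open>u\<^sub>-\<^sub>1 = 0\<close> is a multiple of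
  \<open>P\<^sub>n(z)\<close>, so \<open>z\<close> is an eigenvalue of the Jacobi operator with coefficients \<open>a\<^sub>n, b\<^sub>n\<close> in
  \<open>\<ell>\<^sup>2\<close> (on its maximal domain) precisely when the sequence \<open>P\<^sub>n(z)\<close> is square summable.
\<close>

definition jacobi_eigenvalues :: "(nat \<Rightarrow> real) \<Rightarrow> (nat \<Rightarrow> real) \<Rightarrow> complex set" where
  "jacobi_eigenvalues a b = {z. summable (\<lambda>n. (cmod (poly (orth_poly a b n) z))\<^sup>2)}"

text \<open>\<open>f\<^sub>n(z) = O(g\<^sub>n)\<close> as \<open>n \<rightarrow> \<infinity>\<close>, uniformly in \<open>z\<close> from compact subsets of \<open>S\<close>.\<close>

definition bigo_unif_on_compacts ::
    "complex set \<Rightarrow> (nat \<Rightarrow> complex \<Rightarrow> complex) \<Rightarrow> (nat \<Rightarrow> real) \<Rightarrow> bool" where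
  "bigo_unif_on_compacts S f g \<longleftrightarrow>
     (\<forall>K. compact K \<and> K \<subseteq> S \<longrightarrow>
        (\<exists>C. \<forall>\<^sub>F n in sequentially. \<forall>z\<in>K. cmod (f n z) \<le> C * g n))"

end

theory Submission
  imports Defs "HOL-Real_Asymp.Real_Asymp"
begin

text \<open>
  With \<open>u\<^sub>n = \<nu>\<^sup>n P\<^sub>n\<close> the recurrence becomes \<open>a\<^sub>n u\<^sub>n\<^sub>+\<^sub>1 + \<nu> (b\<^sub>n - z) u\<^sub>n + a\<^sub>n\<^sub>-\<^sub>1 u\<^sub>n\<^sub>-\<^sub>1 = 0\<close>. The two sequences
  \<open>n\<^sup>s exp (\<plusminus> 2 k \<surd>n)\<close> with \<open>k\<^sup>2 = \<tau>\<close> and \<open>s = - \<sigma>/2 + 1/4\<close> solve it for \<open>z = 0\<close> up to a relative error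
  \<open>O(n\<^sup>\<sigma>\<^sup>-\<^sup>2)\<close>: the choice of \<open>k\<close> removes the terms of relative order \<open>1/n\<close> and that of \<open>s\<close> those of
  order \<open>n powr (-3/2)\<close>. Their Casorati determinant has relative size \<open>n powr (-1/2)\<close>, so that by variation
  of constants the coefficients \<open>X\<close>, \<open>Y\<close> of \<open>u\<close> with respect to them change by a relative amount
  \<open>O(n powr (-1-\<rho>))\<close>, locally uniformly in \<open>z\<close>. Hence they converge with rate \<open>n powr (-\<rho>)\<close>. In the case
  \<open>\<tau> > 0\<close> only the coefficient \<open>X\<close> of the growing approximant is controlled in this way, and
  \<open>\<kappa> = lim X\<close>; if it vanishes, an invariant cone forces \<open>u\<close> to decay like the small approximant.
\<close>

section \<open>The WKB approximants\<close>

lemma bigo_of_real: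
  assumes "f \<in> O[F](g)" shows "(\<lambda>n. complex_of_real (f n)) \<in> O[F](\<lambda>n. complex_of_real (g n))"
proof -
  from assms have "(\<lambda>n. norm (complex_of_real (f n))) \<in> O[F](\<lambda>n. norm (complex_of_real (g n)))"
    by simp
  then show ?thesis by (simp only: landau_o.big.norm_iff)
qed

lemma bigo_diff_trans:
  fixes f g k h :: "'a \<Rightarrow> 'b::real_normed_field"
  assumes "(\<lambda>x. f x - g x) \<in> O[F](h)" "(\<lambda>x. g x - k x) \<in> O[F](h)"
  shows "(\<lambda>x. f x - k x) \<in> O[F](h)"
  using sum_in_bigo(1)[OF assms] by simp

text \<open>The splitting \<open>(f - f') * g + f' * (g - g')\<close> asks for a bound on one exact
  and one approximate factor.\<close>

lemma bigo_mult_approx: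
  fixes f g f' g' h :: "'a \<Rightarrow> 'b::real_normed_field"
  assumes "(\<lambda>x. f x - f' x) \<in> O[F](h)" "(\<lambda>x. g x - g' x) \<in> O[F](h)"
    and "g \<in> O[F](\<lambda>_. 1)" "f' \<in> O[F](\<lambda>_. 1)"
  shows "(\<lambda>x. f x * g x - f' x * g' x) \<in> O[F](h)"
proof -
  have "(\<lambda>x. (f x - f' x) * g x + f' x * (g x - g' x)) \<in> O[F](h)"
    using landau_o.big.mult[OF assms(1,3)] landau_o.big.mult[OF assms(4,2)]
    by (intro sum_in_bigo) simp_all
  then show ?thesis by (simp add: algebra_simps)
qed

lemma powr_shift_expansions:
  fixes s :: real
  shows "(\<lambda>n. ((real n + 1) / real n) powr s - (1 + s / real n)) \<in> O(\<lambda>n. 1 / real n ^ 2)"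
    and "(\<lambda>n. ((real n - 1) / real n) powr s - (1 - s / real n)) \<in> O(\<lambda>n. 1 / real n ^ 2)"
  \<comment> \<open>The coefficient s(s-1)/2 of 1/n^2 vanishes for \<open>s = 0\<close> and
    \<open>s = 1\<close>, where the expansion stops at first order; the fallback splits these
    exponents off.\<close>
  by (real_asymp | (cases "s = 0 \<or> s = 1"; real_asymp))+

lemma sqrt_shift_expansions:
  shows "(\<lambda>n. sqrt (real n + 1) - sqrt (real n) - (real n powr (-1/2) / 2 - real n powr (-3/2) / 8))
     \<in> O(\<lambda>n. 1 / real n ^ 2)"
   and "(\<lambda>n. sqrt (real n) - sqrt (real n - 1) - (real n powr (-1/2) / 2 + real n powr (-3/2) / 8))
     \<in> O(\<lambda>n. 1 / real n ^ 2)"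
  by real_asymp+


lemma bigo_cmult: "f \<in> O[F](g) \<Longrightarrow> (\<lambda>x. c * f x) \<in> O[F](g)" for c :: complex
  by (cases "c = 0") auto

lemma bigo_one_if_convergent:
  fixes f :: "nat \<Rightarrow> complex"
  assumes "f \<longlonglongrightarrow> L" shows "f \<in> O(\<lambda>_. 1)"
  by (rule bigoI_tendsto[where c = L]) (use assms in auto)

text \<open>A Taylor polynomial of degree 3 is needed because \<open>h\<close> will be of order
  n^(-1/2): the remainder then has order n^(-2), the accuracy of the assumed expansions of the
  coefficients.\<close>

lemma exp_cubic_approx:
  fixes w :: "nat \<Rightarrow> complex"
  assumes w: "w \<in> O(h)" and h: "h \<longlonglongrightarrow> 0"
  shows "(\<lambda>n. exp (w n) - (1 + w n + w n ^ 2 / 2 + w n ^ 3 / 6)) \<in> O(\<lambda>n. h n ^ 4)"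
proof -
  have "w \<in> o(\<lambda>_. 1)"
    using w h by (intro landau_o.big_small_trans[OF w] smalloI_tendsto) auto
  then have "w \<longlonglongrightarrow> 0"
    using smalloD_tendsto by fastforce
  then have "eventually (\<lambda>n. norm (w n) < 1) sequentially"
    by (metis norm_zero order_tendstoD(2) tendsto_norm zero_less_one)
  then have "(\<lambda>n. exp (w n) - (1 + w n + w n ^ 2 / 2 + w n ^ 3 / 6)) \<in> O(\<lambda>n. w n ^ 4)"
  proof (intro bigoI[where c = "exp 1"], eventually_elim)
    case (elim n)
    have "norm (exp (w n) - (1 + w n + w n ^ 2 / 2 + w n ^ 3 / 6)) \<le> exp \<bar>Re (w n)\<bar> * norm (w n) ^ 4 / 6"
      using Taylor_exp[of "w n" 3] by (simp add: eval_nat_numeral fact_numeral algebra_simps)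
    also have "\<dots> \<le> exp \<bar>Re (w n)\<bar> * norm (w n) ^ 4"
      by simp
    also have "\<dots> \<le> exp 1 * norm (w n) ^ 4"
      using elim abs_Re_le_cmod[of "w n"] by (intro mult_right_mono) auto
    finally show ?case by (simp add: norm_power)
  qed
  also have "(\<lambda>n. w n ^ 4) \<in> O(\<lambda>n. h n ^ 4)"
    using w by (rule landau_o.big_power)
  finally show ?thesis .
qed

text \<open>The expansion variable. Half-integer powers of n become powers of a single complex
  quantity, so that cancellations between expansions turn into polynomial identities.\<close>

definition rsqrt :: "nat \<Rightarrow> complex" where
  "rsqrt n = of_real (real n powr (-1/2))"

lemma rsqrt_tendsto: "rsqrt \<longlonglongrightarrow> 0"
proof -
  have "(\<lambda>n. real n powr (-1/2)) \<longlonglongrightarrow> 0" by real_asymp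
  then have "(\<lambda>n. complex_of_real (real n powr (-1/2))) \<longlonglongrightarrow> of_real 0"
    by (rule tendsto_of_real)
  then show ?thesis by (simp add: rsqrt_def[abs_def])
qed

lemma rsqrt_powers:
  assumes "n > 0"
  shows "rsqrt n ^ 2 = of_real (1 / real n)" "rsqrt n ^ 3 = of_real (real n powr (-3/2))"
    "rsqrt n ^ 4 = of_real (1 / real n ^ 2)"
proof -
  have *: "(real n powr (-1/2)) ^ j = real n powr (- real j / 2)" for j :: nat
    using assms by (simp add: powr_powr flip: powr_realpow)
  have "(real n powr (-1/2)) ^ 2 = 1 / real n" "(real n powr (-1/2)) ^ 3 = real n powr (-3/2)"
    "(real n powr (-1/2)) ^ 4 = 1 / real n ^ 2"
    unfolding * using assms by (simp_all add: powr_minus powr_realpow field_simps)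
  from this[THEN arg_cong[where f = complex_of_real]]
  show "rsqrt n ^ 2 = of_real (1 / real n)" "rsqrt n ^ 3 = of_real (real n powr (-3/2))"
    "rsqrt n ^ 4 = of_real (1 / real n ^ 2)"
    by (simp_all add: rsqrt_def)
qed

lemma bigo_rsqrt_four:
  "(\<lambda>n. f n :: complex) \<in> O(\<lambda>n. rsqrt n ^ 4) \<longleftrightarrow> f \<in> O(\<lambda>n. of_real (1 / real n ^ 2))"
  by (rule landau_o.big.cong_ex) (auto intro!: eventually_sequentiallyI[of 1] simp: rsqrt_powers(3))

lemma poly_rsqrt_bigo:
  assumes "p \<longlonglongrightarrow> L" shows "(\<lambda>n. rsqrt n ^ j * p n) \<in> O(\<lambda>n. rsqrt n ^ j)"
  using landau_o.big.mult[OF landau_o.big_refl bigo_one_if_convergent[OF assms]] by simp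

text \<open>The exponent \<open>w\<close> and its truncation \<open>v\<close> differ by order 4 in
  \<open>rsqrt\<close>, hence so do their squares and cubes, and the cubic Taylor polynomial may be
  evaluated at \<open>v\<close>. The parameter \<open>c\<close> is -1/8 for a forward step of the
  square root and 1/8 for a backward one.\<close>

lemma exp_expansion:
  fixes k :: complex and x :: "nat \<Rightarrow> real" and c :: real
  assumes "(\<lambda>n. x n - (real n powr (-1/2) / 2 + c * real n powr (-3/2))) \<in> O(\<lambda>n. 1 / real n ^ 2)"
  shows "(\<lambda>n. exp (2 * k * of_real (x n)) -
           (1 + k * rsqrt n + k\<^sup>2 / 2 * rsqrt n ^ 2 + (2 * k * of_real c + k ^ 3 / 6) * rsqrt n ^ 3))
         \<in> O(\<lambda>n. rsqrt n ^ 4)"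
proof -
  let ?h = rsqrt
  define w where "w n = 2 * k * of_real (x n)" for n
  define v where "v n = k * ?h n + 2 * k * of_real c * ?h n ^ 3" for n
  have wv: "(\<lambda>n. w n - v n) \<in> O(\<lambda>n. ?h n ^ 4)"
  proof -
    have "(\<lambda>n. 2 * k * of_real (x n - (real n powr (-1/2) / 2 + c * real n powr (-3/2))))
        \<in> O(\<lambda>n. of_real (1 / real n ^ 2))"
      by (intro bigo_cmult bigo_of_real assms)
    then have "(\<lambda>n. 2 * k * of_real (x n - (real n powr (-1/2) / 2 + c * real n powr (-3/2))))
        \<in> O(\<lambda>n. ?h n ^ 4)"
      by (simp only: bigo_rsqrt_four)
    moreover have "eventually (\<lambda>n. w n - v n =
        2 * k * of_real (x n - (real n powr (-1/2) / 2 + c * real n powr (-3/2)))) sequentially"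
      using eventually_gt_at_top[of 0]
      by eventually_elim (simp add: w_def v_def rsqrt_powers, simp add: rsqrt_def algebra_simps)
    ultimately show ?thesis
      by (simp only: landau_o.big.in_cong)
  qed
  have vO: "v \<in> O(?h)"
  proof -
    have "(\<lambda>n. ?h n ^ 1 * (k + 2 * k * of_real c * ?h n ^ 2)) \<in> O(\<lambda>n. ?h n ^ 1)"
      by (rule poly_rsqrt_bigo) (rule tendsto_intros rsqrt_tendsto)+
    then show ?thesis unfolding v_def by (simp add: algebra_simps eval_nat_numeral)
  qed
  have h3: "(\<lambda>n. ?h n ^ 4) \<in> O(?h)"
    using poly_rsqrt_bigo[OF tendsto_power[OF rsqrt_tendsto, of 3], of 1] by (simp add: eval_nat_numeral)
  have wO: "w \<in> O(?h)"
    using sum_in_bigo(1)[OF landau_o.big_trans[OF wv h3] vO] by simp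
  have h1: "?h \<in> O(\<lambda>_. 1)"
    by (rule bigo_one_if_convergent[OF rsqrt_tendsto])
  have w1: "w \<in> O(\<lambda>_. 1)" and v1: "v \<in> O(\<lambda>_. 1)"
    using wO vO h1 landau_o.big_trans by blast+
  have sq: "(\<lambda>n. w n ^ 2 - v n ^ 2) \<in> O(\<lambda>n. ?h n ^ 4)"
    using bigo_mult_approx[OF wv wv w1 v1] by (simp add: power2_eq_square)
  have cu: "(\<lambda>n. w n ^ 3 - v n ^ 3) \<in> O(\<lambda>n. ?h n ^ 4)"
    using bigo_mult_approx[OF sq wv w1] landau_o.big_power[OF v1, of 2]
    by (simp add: eval_nat_numeral mult.assoc)
  have e: "(\<lambda>n. exp (w n) - (1 + w n + w n ^ 2 / 2 + w n ^ 3 / 6)) \<in> O(\<lambda>n. ?h n ^ 4)"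
    by (rule exp_cubic_approx[OF wO rsqrt_tendsto])
  define d where "d = 2 * k * of_real c"
  \<comment> \<open>These are exactly the terms of degree at least 4 in \<open>?h\<close> of the
    cubic Taylor polynomial at \<open>v\<close>.\<close>
  have p: "(\<lambda>n. ?h n ^ 4 * (k * d + d ^ 2 / 2 * ?h n ^ 2 + k ^ 2 * d / 2 * ?h n + k * d ^ 2 / 2 * ?h n ^ 3
               + d ^ 3 / 6 * ?h n ^ 5)) \<in> O(\<lambda>n. ?h n ^ 4)"
    by (rule poly_rsqrt_bigo) (rule tendsto_intros rsqrt_tendsto)+
  have "(\<lambda>n. (exp (w n) - (1 + w n + w n ^ 2 / 2 + w n ^ 3 / 6)) + (w n - v n)
        + (1 / 2) * (w n ^ 2 - v n ^ 2) + (1 / 6) * (w n ^ 3 - v n ^ 3)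
        + ?h n ^ 4 * (k * d + d ^ 2 / 2 * ?h n ^ 2 + k ^ 2 * d / 2 * ?h n + k * d ^ 2 / 2 * ?h n ^ 3
               + d ^ 3 / 6 * ?h n ^ 5)) \<in> O(\<lambda>n. ?h n ^ 4)"
    by (intro sum_in_bigo e wv p bigo_cmult sq cu)
  also have "(\<lambda>n. (exp (w n) - (1 + w n + w n ^ 2 / 2 + w n ^ 3 / 6)) + (w n - v n)
        + (1 / 2) * (w n ^ 2 - v n ^ 2) + (1 / 6) * (w n ^ 3 - v n ^ 3)
        + ?h n ^ 4 * (k * d + d ^ 2 / 2 * ?h n ^ 2 + k ^ 2 * d / 2 * ?h n + k * d ^ 2 / 2 * ?h n ^ 3
               + d ^ 3 / 6 * ?h n ^ 5)) =
     (\<lambda>n. exp (2 * k * of_real (x n)) -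
           (1 + k * rsqrt n + k\<^sup>2 / 2 * rsqrt n ^ 2 + (2 * k * of_real c + k ^ 3 / 6) * rsqrt n ^ 3))"
    unfolding d_def[symmetric] by (intro ext) (simp add: v_def w_def d_def[symmetric], simp add: field_simps eval_nat_numeral)
  finally show ?thesis .
qed

text \<open>Both approximants come from this formula, through the sign of \<open>k\<close>. As
  \<open>0 powr s\<close> is 0, the sequence vanishes at index 0, and quotients of approximants are
  taken for \<open>n > 0\<close> only.\<close>

definition wkb :: "real \<Rightarrow> complex \<Rightarrow> nat \<Rightarrow> complex" where
  "wkb s k n = of_real (real n powr s) * exp (2 * k * of_real (sqrt (real n)))"

lemma wkb_Suc:
  assumes "n > 0"
  shows "wkb s k (Suc n) = wkb s k n *
    (of_real (((real n + 1) / real n) powr s) * exp (2 * k * of_real (sqrt (real n + 1) - sqrt (real n))))"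
proof -
  have "real n powr s * (((real n + 1) / real n) powr s) = (real n + 1) powr s"
    using assms by (simp flip: powr_mult)
  note 1 = this[THEN arg_cong[where f = complex_of_real], unfolded of_real_mult, symmetric]
  have 2: "exp (2 * k * of_real (sqrt (real n + 1))) = exp (2 * k * of_real (sqrt (real n))) *
      exp (2 * k * of_real (sqrt (real n + 1) - sqrt (real n)))"
    by (simp add: algebra_simps flip: exp_add)
  show ?thesis
    unfolding wkb_def of_nat_Suc add.commute[of 1 "real n"] 1 2 by (simp only: mult_ac)
qed

text \<open>The minus sign is attached to \<open>k\<close>, so that the increment of the square root
  stays positive and \<open>exp_expansion\<close> applies with \<open>- k\<close>.\<close>

lemma wkb_pred:
  assumes "n > 1"
  shows "wkb s k (n - 1) = wkb s k n *
    (of_real (((real n - 1) / real n) powr s) * exp (2 * (- k) * of_real (sqrt (real n) - sqrt (real n - 1))))"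
proof -
  have "real n powr s * (((real n - 1) / real n) powr s) = (real n - 1) powr s"
    using assms by (simp flip: powr_mult)
  note 1 = this[THEN arg_cong[where f = complex_of_real], unfolded of_real_mult, symmetric]
  have 2: "exp (2 * k * of_real (sqrt (real n - 1))) = exp (2 * k * of_real (sqrt (real n))) *
      exp (2 * (- k) * of_real (sqrt (real n) - sqrt (real n - 1)))"
    by (simp add: algebra_simps flip: exp_add)
  have 3: "real (n - 1) = real n - 1" using assms by simp
  show ?thesis
    unfolding wkb_def 3 1 2 by (simp only: mult_ac)
qed

text \<open>After division by n^\<open>\<sigma>\<close> and the approximant, the left side is a
  polynomial in h = \<open>rsqrt n\<close> up to order h^4. Its coefficients are 1 + 1 - 2 at order
  0, k - k at order 1, k^2 - (2 \<open>\<beta>\<close> - 2 \<open>\<alpha>\<close> +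
  \<open>\<sigma>\<close>) at order 2 and k (2 s + \<open>\<sigma>\<close> - 1/2) at order 3. The
  assumptions on \<open>k\<close> and \<open>s\<close> make the last two vanish.\<close>

lemma wkb_residual:
  fixes a b :: "nat \<Rightarrow> real" and k :: complex and \<alpha> \<beta> \<sigma> s :: real
  assumes a: "(\<lambda>n. a n / real n powr \<sigma> - (1 + \<alpha> / real n)) \<in> O(\<lambda>n. 1 / real n ^ 2)"
    and b: "(\<lambda>n. b n / real n powr \<sigma> + 2 * (1 + \<beta> / real n)) \<in> O(\<lambda>n. 1 / real n ^ 2)"
    and k: "k\<^sup>2 = of_real (2 * \<beta> - 2 * \<alpha> + \<sigma>)" and s: "s = - \<sigma> / 2 + 1 / 4"
  shows "\<exists>C>0. \<forall>\<^sub>F n in sequentially.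
    norm (of_real (a n) * wkb s k (Suc n) + of_real (b n) * wkb s k n + of_real (a (n - 1)) * wkb s k (n - 1))
      \<le> C * real n powr (\<sigma> - 2) * norm (wkb s k n)"
proof -
  define F1 where "F1 n = a n / real n powr \<sigma> * ((real n + 1) / real n) powr s" for n
  \<comment> \<open>The exponent \<open>\<sigma> + s\<close> absorbs the passage from
    (n-1)^\<open>\<sigma>\<close> to n^\<open>\<sigma>\<close>.\<close>
  define F2 where "F2 n = a (n - 1) / real (n - 1) powr \<sigma> * ((real n - 1) / real n) powr (\<sigma> + s)" for n
  define X1 where "X1 n = exp (2 * k * of_real (sqrt (real n + 1) - sqrt (real n)))" for n
  define X2 where "X2 n = exp (2 * (- k) * of_real (sqrt (real n) - sqrt (real n - 1)))" for n
  have bounded: "(\<lambda>n. ((real n + 1) / real n) powr p) \<in> O(\<lambda>_. 1)"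
    "(\<lambda>n. ((real n - 1) / real n) powr p) \<in> O(\<lambda>_. 1)" "(\<lambda>n. 1 + p / real n) \<in> O(\<lambda>_. 1)" for p
    by real_asymp+
  have "(\<lambda>n. F1 n - (1 + \<alpha> / real n) * (1 + s / real n)) \<in> O(\<lambda>n. 1 / real n ^ 2)"
    unfolding F1_def by (intro bigo_mult_approx a powr_shift_expansions bounded)
  moreover have "(\<lambda>n. (1 + \<alpha> / real n) * (1 + s / real n) - (1 + (\<alpha> + s) / real n)) \<in> O(\<lambda>n. 1 / real n ^ 2)"
    by real_asymp
  ultimately have F1: "(\<lambda>n. F1 n - (1 + (\<alpha> + s) / real n)) \<in> O(\<lambda>n. 1 / real n ^ 2)"
    by (rule bigo_diff_trans)
  have "filterlim (\<lambda>n. n - 1 :: nat) sequentially sequentially" by real_asymp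
  from landau_o.big.compose[OF a this]
  have "(\<lambda>n. a (n - 1) / real (n - 1) powr \<sigma> - (1 + \<alpha> / real (n - 1))) \<in> O(\<lambda>n. 1 / real (n - 1) ^ 2)" .
  also have "(\<lambda>n. 1 / real (n - 1) ^ 2) \<in> O(\<lambda>n. 1 / real n ^ 2)" by real_asymp
  finally have "(\<lambda>n. a (n - 1) / real (n - 1) powr \<sigma> - (1 + \<alpha> / real (n - 1))) \<in> O(\<lambda>n. 1 / real n ^ 2)" .
  moreover have "(\<lambda>n. 1 + \<alpha> / real (n - 1)) \<in> O(\<lambda>_. 1)" by real_asymp
  ultimately have "(\<lambda>n. F2 n - (1 + \<alpha> / real (n - 1)) * (1 - (\<sigma> + s) / real n)) \<in> O(\<lambda>n. 1 / real n ^ 2)"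
    unfolding F2_def by (intro bigo_mult_approx powr_shift_expansions bounded)
  moreover have "(\<lambda>n. (1 + \<alpha> / real (n - 1)) * (1 - (\<sigma> + s) / real n) - (1 + (\<alpha> - \<sigma> - s) / real n))
      \<in> O(\<lambda>n. 1 / real n ^ 2)"
    by real_asymp
  ultimately have F2: "(\<lambda>n. F2 n - (1 + (\<alpha> - \<sigma> - s) / real n)) \<in> O(\<lambda>n. 1 / real n ^ 2)"
    by (rule bigo_diff_trans)

  let ?h = rsqrt
  have to_complex: "(\<lambda>n. of_real (f n) - (of_real c + of_real d * ?h n ^ 2)) \<in> O(\<lambda>n. ?h n ^ 4)"
    if "(\<lambda>n. f n - (c + d / real n)) \<in> O(\<lambda>n. 1 / real n ^ 2)" for f c d
  proof -
    have "(\<lambda>n. complex_of_real (f n - (c + d / real n))) \<in> O(\<lambda>n. ?h n ^ 4)"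
      using bigo_of_real[OF that] by (simp only: bigo_rsqrt_four)
    moreover have "eventually (\<lambda>n. of_real (f n) - (of_real c + of_real d * ?h n ^ 2) =
        complex_of_real (f n - (c + d / real n))) sequentially"
      using eventually_gt_at_top[of 0] by eventually_elim (simp add: rsqrt_powers)
    ultimately show ?thesis by (simp only: landau_o.big.in_cong)
  qed
  define f1 where "f1 n = of_real 1 + of_real (\<alpha> + s) * ?h n ^ 2" for n
  define f2 where "f2 n = of_real 1 + of_real (\<alpha> - \<sigma> - s) * ?h n ^ 2" for n
  define x1 where "x1 n = 1 + k * ?h n + k\<^sup>2 / 2 * ?h n ^ 2 + (2 * k * of_real (- 1 / 8) + k ^ 3 / 6) * ?h n ^ 3" for n
  define x2 where "x2 n = 1 + (- k) * ?h n + (- k)\<^sup>2 / 2 * ?h n ^ 2 + (2 * (- k) * of_real (1 / 8) + (- k) ^ 3 / 6) * ?h n ^ 3" for n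
  have X1: "(\<lambda>n. X1 n - x1 n) \<in> O(\<lambda>n. ?h n ^ 4)"
    unfolding X1_def x1_def using sqrt_shift_expansions(1) by (intro exp_expansion) simp
  have X2: "(\<lambda>n. X2 n - x2 n) \<in> O(\<lambda>n. ?h n ^ 4)"
    unfolding X2_def x2_def using sqrt_shift_expansions(2) by (intro exp_expansion) simp
  have f1: "(\<lambda>n. of_real (F1 n) - f1 n) \<in> O(\<lambda>n. ?h n ^ 4)"
    unfolding f1_def by (rule to_complex[OF F1])
  have f2: "(\<lambda>n. of_real (F2 n) - f2 n) \<in> O(\<lambda>n. ?h n ^ 4)"
    unfolding f2_def by (rule to_complex[OF F2])
  have fx_bounded: "f1 \<in> O(\<lambda>_. 1)" "f2 \<in> O(\<lambda>_. 1)"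
    unfolding f1_def f2_def by (rule bigo_one_if_convergent, (rule tendsto_intros rsqrt_tendsto)+)+
  have X_bounded: "X1 \<in> O(\<lambda>_. 1)" "X2 \<in> O(\<lambda>_. 1)"
  proof -
    have exp_bounded: "(\<lambda>n. exp (2 * c * of_real (x n))) \<in> O(\<lambda>_. 1)"
      if "x \<longlonglongrightarrow> 0" for x :: "nat \<Rightarrow> real" and c :: complex
      by (rule bigo_one_if_convergent) (rule tendsto_intros that)+
    show "X1 \<in> O(\<lambda>_. 1)" unfolding X1_def by (rule exp_bounded) real_asymp
    show "X2 \<in> O(\<lambda>_. 1)" unfolding X2_def by (rule exp_bounded) real_asymp
  qed
  have "(\<lambda>n. of_real (b n / real n powr \<sigma>) - (of_real (-2) + of_real (- 2 * \<beta>) * ?h n ^ 2)) \<in> O(\<lambda>n. ?h n ^ 4)"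
    using b by (intro to_complex) (simp add: algebra_simps)
  moreover have "(\<lambda>n. of_real (F1 n) * X1 n - f1 n * x1 n) \<in> O(\<lambda>n. ?h n ^ 4)"
    "(\<lambda>n. of_real (F2 n) * X2 n - f2 n * x2 n) \<in> O(\<lambda>n. ?h n ^ 4)"
    by (intro bigo_mult_approx f1 f2 X1 X2 fx_bounded X_bounded)+
  \<comment> \<open>\<open>e1\<close> and \<open>e2\<close> are the cubic coefficients of
    \<open>x1\<close> and \<open>x2\<close>. The remainder below consists of the terms of degree 4
    and 5 in \<open>f1 n * x1 n + f2 n * x2 n\<close>.\<close>
  moreover define e1 where "e1 = k ^ 3 / 6 - k / 4"
  moreover define e2 where "e2 = - (k ^ 3 / 6) - k / 4"
  moreover have "(\<lambda>n. ?h n ^ 4 * ((2 * of_real \<alpha> - of_real \<sigma>) * k\<^sup>2 / 2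
      + (of_real (\<alpha> + s) * e1 + of_real (\<alpha> - \<sigma> - s) * e2) * ?h n)) \<in> O(\<lambda>n. ?h n ^ 4)"
    by (rule poly_rsqrt_bigo) (rule tendsto_intros rsqrt_tendsto)+
  ultimately have "(\<lambda>n. (of_real (F1 n) * X1 n - f1 n * x1 n) + (of_real (F2 n) * X2 n - f2 n * x2 n)
      + (of_real (b n / real n powr \<sigma>) - (of_real (-2) + of_real (- 2 * \<beta>) * ?h n ^ 2))
      + ?h n ^ 4 * ((2 * of_real \<alpha> - of_real \<sigma>) * k\<^sup>2 / 2
          + (of_real (\<alpha> + s) * e1 + of_real (\<alpha> - \<sigma> - s) * e2) * ?h n)) \<in> O(\<lambda>n. ?h n ^ 4)"
    by (intro sum_in_bigo(1))
  also have "(\<lambda>n. (of_real (F1 n) * X1 n - f1 n * x1 n) + (of_real (F2 n) * X2 n - f2 n * x2 n)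
      + (of_real (b n / real n powr \<sigma>) - (of_real (-2) + of_real (- 2 * \<beta>) * ?h n ^ 2))
      + ?h n ^ 4 * ((2 * of_real \<alpha> - of_real \<sigma>) * k\<^sup>2 / 2
          + (of_real (\<alpha> + s) * e1 + of_real (\<alpha> - \<sigma> - s) * e2) * ?h n))
    = (\<lambda>n. of_real (F1 n) * X1 n + of_real (F2 n) * X2 n + of_real (b n / real n powr \<sigma>))"
  proof
    fix n
    \<comment> \<open>Eliminating \<open>\<beta>\<close> through k^2 leaves the cancellation of all
      orders below 4 as a plain polynomial identity.\<close>
    have beta: "complex_of_real \<beta> = (k\<^sup>2 + 2 * of_real \<alpha> - of_real \<sigma>) / 2"
      using k by simp
    have "f1 n * x1 n + f2 n * x2 n - 2 - 2 * of_real \<beta> * ?h n ^ 2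
       = ?h n ^ 4 * ((2 * of_real \<alpha> - of_real \<sigma>) * k\<^sup>2 / 2
          + (of_real (\<alpha> + s) * e1 + of_real (\<alpha> - \<sigma> - s) * e2) * ?h n)"
      unfolding f1_def f2_def x1_def x2_def e1_def e2_def beta s
      by (simp add: field_simps) (simp add: algebra_simps eval_nat_numeral)
    then show "(of_real (F1 n) * X1 n - f1 n * x1 n) + (of_real (F2 n) * X2 n - f2 n * x2 n)
      + (of_real (b n / real n powr \<sigma>) - (of_real (-2) + of_real (- 2 * \<beta>) * ?h n ^ 2))
      + ?h n ^ 4 * ((2 * of_real \<alpha> - of_real \<sigma>) * k\<^sup>2 / 2
          + (of_real (\<alpha> + s) * e1 + of_real (\<alpha> - \<sigma> - s) * e2) * ?h n)
      = of_real (F1 n) * X1 n + of_real (F2 n) * X2 n + of_real (b n / real n powr \<sigma>)"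
      by (simp add: algebra_simps)
  qed
  finally have "(\<lambda>n. of_real (F1 n) * X1 n + of_real (F2 n) * X2 n + of_real (b n / real n powr \<sigma>))
      \<in> O(\<lambda>n. complex_of_real (1 / real n ^ 2))"
    by (simp only: bigo_rsqrt_four)
  then obtain C where C: "C > 0" and ev: "\<forall>\<^sub>F n in sequentially.
      norm (of_real (F1 n) * X1 n + of_real (F2 n) * X2 n + of_real (b n / real n powr \<sigma>))
       \<le> C * norm (complex_of_real (1 / real n ^ 2))"
    by (elim landau_o.bigE)
  have "\<forall>\<^sub>F n in sequentially.
    norm (of_real (a n) * wkb s k (Suc n) + of_real (b n) * wkb s k n + of_real (a (n - 1)) * wkb s k (n - 1))
      \<le> C * real n powr (\<sigma> - 2) * norm (wkb s k n)"
    using ev eventually_gt_at_top[of 1]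
  proof eventually_elim
    case (elim n)
    let ?r = "((real n - 1) / real n)"
    have "a n * ((real n + 1) / real n) powr s = real n powr \<sigma> * F1 n"
      using elim by (simp add: F1_def)
    note 1 = this[THEN arg_cong[where f = complex_of_real], simplified of_real_mult]
    have "?r powr (\<sigma> + s) * real n powr \<sigma> = (real n - 1) powr \<sigma> * ?r powr s"
      using elim by (simp add: powr_add flip: powr_mult)
    then have "a (n - 1) * ?r powr s = real n powr \<sigma> * F2 n"
      using elim by (simp add: F2_def of_nat_diff field_simps)
    note 2 = this[THEN arg_cong[where f = complex_of_real], simplified of_real_mult]
    have "b n = real n powr \<sigma> * (b n / real n powr \<sigma>)" using elim by simp
    note 3 = this[THEN arg_cong[where f = complex_of_real], simplified of_real_mult]
    have "of_real (a n) * wkb s k (Suc n) + of_real (b n) * wkb s k n + of_real (a (n - 1)) * wkb s k (n - 1)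
       = wkb s k n * (of_real (a n) * of_real (((real n + 1) / real n) powr s) * X1 n + of_real (b n)
           + of_real (a (n - 1)) * of_real (?r powr s) * X2 n)"
      unfolding wkb_Suc[OF order.strict_trans[OF zero_less_one elim(2)]] wkb_pred[OF elim(2)]
        X1_def[symmetric] X2_def[symmetric]
      by (simp add: algebra_simps del: of_real_mult of_real_diff of_real_add of_real_divide)
    also have "\<dots> = wkb s k n * of_real (real n powr \<sigma>) *
        (of_real (F1 n) * X1 n + of_real (F2 n) * X2 n + of_real (b n / real n powr \<sigma>))"
      unfolding 1 2 by (subst 3) (simp add: algebra_simps)
    finally have "norm (of_real (a n) * wkb s k (Suc n) + of_real (b n) * wkb s k n + of_real (a (n - 1)) * wkb s k (n - 1))
       = norm (wkb s k n) * real n powr \<sigma> * norm (of_real (F1 n) * X1 n + of_real (F2 n) * X2 n + of_real (b n / real n powr \<sigma>))"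
      by (simp add: norm_mult)
    also have "\<dots> \<le> norm (wkb s k n) * real n powr \<sigma> * (C * norm (complex_of_real (1 / real n ^ 2)))"
      using elim by (intro mult_left_mono) auto
    also have "\<dots> = C * real n powr (\<sigma> - 2) * norm (wkb s k n)"
      using elim by (simp add: norm_divide norm_power powr_diff powr_realpow)
    finally show ?case .
  qed
  with C show ?thesis by blast
qed

section \<open>Summable perturbations of diagonal systems\<close>

text \<open>Increments dominated by the decrements of a null sequence telescope; letting the upper
  index tend to infinity turns \<open>h n\<close> itself into the rate of convergence.\<close>

lemma cauchy_of_telescoping_bound:
  fixes X :: "nat \<Rightarrow> 'a::banach" and h :: "nat \<Rightarrow> real"
  assumes inc: "\<And>n. n \<ge> N \<Longrightarrow> norm (X (Suc n) - X n) \<le> h n - h (Suc n)" and h: "h \<longlonglongrightarrow> 0"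
  shows "convergent X" and "\<And>n. n \<ge> N \<Longrightarrow> norm (X n - lim X) \<le> h n"
proof -
  have *: "norm (X m - X n) \<le> h n - h m" if "N \<le> n" "n \<le> m" for m n
    using that(2)
  proof (induction m rule: dec_induct)
    case (step m)
    then show ?case
      using inc[of m] that norm_triangle_ineq[of "X (Suc m) - X m" "X m - X n"] by simp
  qed simp
  have "Cauchy X"
  proof (rule CauchyI)
    fix e :: real assume "e > 0"
    have "Cauchy h" using h by (simp add: LIMSEQ_imp_Cauchy)
    then obtain M where M: "\<And>m n. m \<ge> M \<Longrightarrow> n \<ge> M \<Longrightarrow> norm (h m - h n) < e"
      using \<open>e > 0\<close> by (meson CauchyD)
    have "norm (X m - X n) < e" if "m \<ge> max M N" "n \<ge> max M N" for m n
      using *[of n m] *[of m n] M[of m n] that norm_minus_commute[of "X m" "X n"]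
      by (cases "n \<le> m") auto
    then show "\<exists>M. \<forall>m\<ge>M. \<forall>n\<ge>M. norm (X m - X n) < e" by blast
  qed
  then show conv: "convergent X" by (simp add: Cauchy_convergent)
  fix n assume n: "n \<ge> N"
  have "(\<lambda>m. norm (X n - X m)) \<longlonglongrightarrow> norm (X n - lim X)"
    using conv by (intro tendsto_intros) (simp add: convergent_LIMSEQ_iff)
  moreover have "(\<lambda>m. h n - h m) \<longlonglongrightarrow> h n - 0"
    by (intro tendsto_intros h)
  moreover have "\<exists>M. \<forall>m\<ge>M. norm (X n - X m) \<le> h n - h m"
    using *[OF n] by (intro exI[of _ n]) (simp add: norm_minus_commute)
  ultimately show "norm (X n - lim X) \<le> h n"
    using LIMSEQ_le[of _ _ "\<lambda>m. h n - h m" "h n - 0"] by simp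
qed

text \<open>The difference on the right is asymptotic to \<open>\<rho>\<close>
  n^(-1-\<open>\<rho>\<close>), and the factor 2 absorbs the error. This gives explicit tail bounds
  without estimating series.\<close>

lemma powr_telescope:
  assumes "\<rho> > 0" shows
  "eventually (\<lambda>n. real n powr (-1-\<rho>) \<le> 2/\<rho> * (real n powr (-\<rho>) - real (Suc n) powr (-\<rho>))) sequentially"
  using assms by real_asymp

lemma gronwall_exp:
  fixes t f :: "nat \<Rightarrow> real"
  assumes f: "summable f" "\<And>n. f n \<ge> 0" and t: "t N \<ge> 0" and "n \<ge> N"
    and t_Suc: "\<And>m. m \<ge> N \<Longrightarrow> t (Suc m) \<le> exp (f m) * t m"
  shows "t n \<le> t N * exp (suminf f)"
proof -
  have "t n \<le> t N * exp (\<Sum>m=N..<n. f m)"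
    using \<open>n \<ge> N\<close>
  proof (induction n rule: dec_induct)
    case (step n)
    have "t (Suc n) \<le> exp (f n) * t n" by (rule t_Suc) fact
    also have "\<dots> \<le> exp (f n) * (t N * exp (\<Sum>m=N..<n. f m))"
      by (intro mult_left_mono step) auto
    also have "\<dots> = t N * exp (\<Sum>m=N..<Suc n. f m)"
      using step.hyps by (simp add: algebra_simps flip: exp_add)
    finally show ?case .
  qed simp
  also have "\<dots> \<le> t N * exp (suminf f)"
    using sum_le_suminf[OF f(1), of "{N..<n}"] f(2) t by (simp add: mult_left_mono)
  finally show ?thesis .
qed

text \<open>The perturbation system satisfied by the coefficients \<open>X\<close> of the dominant and \<open>Y\<close> of the
  recessive approximant; \<open>E n\<close> is the modulus of the quotient of the two approximants.\<close>

locale perturbed_system =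
  fixes X Y :: "nat \<Rightarrow> complex" and E :: "nat \<Rightarrow> real" and D \<rho> :: real and N :: nat
  assumes D: "D \<ge> 0" and rho: "\<rho> > 0"
    and E_pos: "\<And>n. E n > 0" and E_Suc: "\<And>n. E (Suc n) \<le> E n"
    and X_Suc: "\<And>n. n \<ge> N \<Longrightarrow>
      norm (X (Suc n) - X n) \<le> D * real n powr (-1-\<rho>) * (norm (X n) + E n * norm (Y n))"
    and Y_Suc: "\<And>n. n \<ge> N \<Longrightarrow>
      E (Suc n) * norm (Y (Suc n) - Y n) \<le> D * real n powr (-1-\<rho>) * (norm (X n) + E n * norm (Y n))"
begin

text \<open>The first term on the right keeps \<open>E (Suc n)\<close> instead of the larger
  \<open>E n\<close>: the contraction E(n+1)/E(n) is what later forces decay.\<close>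

lemma EY_Suc:
  assumes "n \<ge> N"
  shows "E (Suc n) * norm (Y (Suc n)) \<le> E (Suc n) * norm (Y n)
    + D * real n powr (-1-\<rho>) * (norm (X n) + E n * norm (Y n))"
proof -
  have "E (Suc n) * norm (Y (Suc n)) \<le> E (Suc n) * (norm (Y n) + norm (Y (Suc n) - Y n))"
    using E_pos[of "Suc n"] norm_triangle_sub[of "Y (Suc n)" "Y n"] by simp
  then show ?thesis using Y_Suc[OF assms] by (simp add: algebra_simps)
qed

text \<open>By monotonicity of \<open>E\<close>, the sum \<open>S\<close> grows in each step by a
  factor of at most 1 + 2 D n^(-1-\<open>\<rho>\<close>), and these factors have a convergent
  product. The bound involves only \<open>D\<close> and the values at \<open>N\<close>, which makes
  it uniform in a parameter.\<close>

lemma bounded: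
  assumes "n \<ge> N"
  shows "norm (X n) + E n * norm (Y n)
    \<le> (norm (X N) + E N * norm (Y N)) * exp (2 * D * (\<Sum>n. real n powr (-1-\<rho>)))"
proof -
  define S where "S m = norm (X m) + E m * norm (Y m)" for m
  have S_nonneg: "S m \<ge> 0" for m using E_pos[of m] by (simp add: S_def)
  have summable: "summable (\<lambda>n. real n powr (-1-\<rho>))"
    using rho by (simp add: summable_real_powr_iff)
  have S_Suc: "S (Suc m) \<le> exp (2 * D * real m powr (-1-\<rho>)) * S m" if "m \<ge> N" for m
  proof -
    have "E (Suc m) * norm (Y m) \<le> E m * norm (Y m)"
      using E_Suc by (intro mult_right_mono) auto
    then have "S (Suc m) \<le> S m + 2 * D * real m powr (-1-\<rho>) * S m"
      using X_Suc[OF that] EY_Suc[OF that] norm_triangle_sub[of "X (Suc m)" "X m"]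
      unfolding S_def by (simp add: algebra_simps)
    also have "\<dots> = (1 + 2 * D * real m powr (-1-\<rho>)) * S m"
      by (simp add: algebra_simps)
    also have "\<dots> \<le> exp (2 * D * real m powr (-1-\<rho>)) * S m"
      using S_nonneg by (intro mult_right_mono exp_ge_add_one_self) auto
    finally show ?thesis .
  qed
  have "S n \<le> S N * exp (\<Sum>n. 2 * D * real n powr (-1-\<rho>))"
    using assms D S_nonneg S_Suc by (intro gronwall_exp summable_mult summable) auto
  then show ?thesis by (simp add: S_def suminf_mult summable)
qed

lemma X_limit:
  assumes M: "\<And>n. n \<ge> N \<Longrightarrow> norm (X n) + E n * norm (Y n) \<le> M"
    and N: "\<And>n. n \<ge> N \<Longrightarrow> real n powr (-1-\<rho>) \<le> 2/\<rho> * (real n powr (-\<rho>) - real (Suc n) powr (-\<rho>))"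
  shows "convergent X" and "\<And>n. n \<ge> N \<Longrightarrow> norm (X n - lim X) \<le> 2 * D * M / \<rho> * real n powr (-\<rho>)"
proof -
  have M0: "M \<ge> 0"
    using M[of N] E_pos[of N] by (intro order.trans[OF _ M[of N]]) auto
  define h where "h n = 2 * D * M / \<rho> * real n powr (-\<rho>)" for n
  have "(\<lambda>n. real n powr (-\<rho>)) \<longlonglongrightarrow> 0" using rho by real_asymp
  from tendsto_mult[OF tendsto_const this, of "2 * D * M / \<rho>"] have h: "h \<longlonglongrightarrow> 0"
    by (simp add: h_def[abs_def])
  have "norm (X (Suc n) - X n) \<le> h n - h (Suc n)" if "n \<ge> N" for n
  proof -
    have "norm (X (Suc n) - X n) \<le> D * real n powr (-1-\<rho>) * M"
      using X_Suc[OF that] mult_left_mono[OF M[OF that], of "D * real n powr (-1-\<rho>)"] D by simp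
    also have "\<dots> = D * M * real n powr (-1-\<rho>)" by simp
    also have "\<dots> \<le> D * M * (2/\<rho> * (real n powr (-\<rho>) - real (Suc n) powr (-\<rho>)))"
      using N[OF that] D M0 by (intro mult_left_mono) auto
    finally show ?thesis by (simp add: h_def algebra_simps)
  qed
  from cauchy_of_telescoping_bound[of N, OF this h] show "convergent X"
    "\<And>n. n \<ge> N \<Longrightarrow> norm (X n - lim X) \<le> 2 * D * M / \<rho> * real n powr (-\<rho>)"
    by (simp_all add: h_def)
qed

text \<open>Induction with the ansatz C n^(-\<open>\<rho>\<close>): the summand \<open>D * M\<close>
  of the constant dominates the forcing term, the summand with \<open>N powr \<rho>\<close> the
  initial value. Assumption \<open>E\<close> says that the contraction outweighs both the forcing
  and the decrease of n^(-\<open>\<rho>\<close>).\<close>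

lemma EY_decay:
  assumes M: "\<And>n. n \<ge> N \<Longrightarrow> norm (X n) + E n * norm (Y n) \<le> M" and "N > 0"
    and E: "\<And>n. n \<ge> N \<Longrightarrow>
      E (Suc n) / E n * real n powr (-\<rho>) + real n powr (-1-\<rho>) \<le> real (Suc n) powr (-\<rho>)"
    and "n \<ge> N"
  shows "E n * norm (Y n) \<le> (D * M + M * real N powr \<rho>) * real n powr (-\<rho>)"
    (is "_ \<le> ?C * _")
  using \<open>n \<ge> N\<close>
proof (induction n rule: dec_induct)
  have M0: "M \<ge> 0"
    using E_pos[of N] by (intro order.trans[OF _ M[of N]]) auto
  have C: "?C \<ge> D * M" using M0 by simp
  {
    case base
    have "E N * norm (Y N) \<le> norm (X N) + E N * norm (Y N)" by simp
    also have "\<dots> \<le> M" by (rule M) simp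
    also have "\<dots> = M * real N powr \<rho> * real N powr (-\<rho>)"
      using \<open>N > 0\<close> by (simp flip: powr_add)
    also have "\<dots> \<le> ?C * real N powr (-\<rho>)"
      using D M0 by (intro mult_right_mono) auto
    finally show ?case .
  next
    case (step n)
    let ?e = "real n powr (-1-\<rho>)"
    have "E (Suc n) * norm (Y (Suc n)) \<le> E (Suc n) * norm (Y n) + D * ?e * M"
      using EY_Suc[OF step.hyps(1)] mult_left_mono[OF M[OF step.hyps(1)], of "D * ?e"] D by simp
    also have "E (Suc n) * norm (Y n) = E (Suc n) / E n * (E n * norm (Y n))"
      using E_pos[of n] by simp
    also have "\<dots> \<le> E (Suc n) / E n * (?C * real n powr (-\<rho>))"
      using E_pos[of n] E_pos[of "Suc n"] by (intro mult_left_mono step) auto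
    also have "D * ?e * M \<le> ?C * ?e"
      using mult_right_mono[OF C, of ?e] by (simp add: mult_ac)
    finally have "E (Suc n) * norm (Y (Suc n)) \<le> ?C * (E (Suc n) / E n * real n powr (-\<rho>) + ?e)"
      by (simp add: algebra_simps add_divide_distrib)
    also have "\<dots> \<le> ?C * real (Suc n) powr (-\<rho>)"
      using C D M0 E[OF step.hyps(1)] by (intro mult_left_mono) auto
    finally show ?case .
  }
qed

text \<open>The cone \<open>\<bar>X\<bar> \<ge> E \<bar>Y\<bar>\<close> is invariant and \<open>\<bar>X\<bar>\<close> cannot tend to zero inside it.
  Hence \<open>\<bar>X\<bar> \<le> E \<bar>Y\<bar>\<close> throughout, and then \<open>Y\<close> is bounded.\<close>

lemma recessive_if_X_null:
  assumes X: "X \<longlonglongrightarrow> 0"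
    and E: "\<And>n. n \<ge> N \<Longrightarrow> E (Suc n) / E n + 4 * D * real n powr (-1-\<rho>) \<le> 1"
    and E2: "\<And>n. n \<ge> N \<Longrightarrow> E n \<le> 2 * E (Suc n)"
  shows "\<exists>C. \<forall>n\<ge>N. norm (X n) + E n * norm (Y n) \<le> C * E n"
proof -
  define f where "f n = 4 * D * real n powr (-1-\<rho>)" for n
  have f: "summable f" "\<And>n. f n \<ge> 0"
    using rho D by (auto simp: f_def[abs_def] summable_real_powr_iff intro!: summable_mult)
  have f_le: "f n \<le> 1" if "n \<ge> N" for n
    using E[OF that] E_pos[of n] E_pos[of "Suc n"] by (simp add: f_def) (smt (verit) divide_pos_pos)
  \<comment> \<open>Inside the cone the perturbation is at most \<open>f m / 2 * norm (X m)\<close>.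
    So the modulus of \<open>X\<close> keeps at least the share 1 - f/2, while the other side is
    contracted to 1 - f and then gains at most f/2: both meet at the same threshold.\<close>
  have cone: "E (Suc m) * norm (Y (Suc m)) \<le> norm (X (Suc m)) \<and> norm (X m) \<le> exp (f m) * norm (X (Suc m))"
    if m: "m \<ge> N" and c: "E m * norm (Y m) \<le> norm (X m)" for m
  proof -
    have "D * real m powr (-1-\<rho>) * (norm (X m) + E m * norm (Y m)) \<le> D * real m powr (-1-\<rho>) * (2 * norm (X m))"
      using c D by (intro mult_left_mono) auto
    then have *: "D * real m powr (-1-\<rho>) * (norm (X m) + E m * norm (Y m)) \<le> f m / 2 * norm (X m)"
      by (simp add: f_def)
    have lower: "(1 - f m / 2) * norm (X m) \<le> norm (X (Suc m))"
      using X_Suc[OF m] * norm_triangle_ineq3[of "X (Suc m)" "X m"] by (simp add: algebra_simps)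
    have "E (Suc m) * norm (Y m) = E (Suc m) / E m * (E m * norm (Y m))"
      using E_pos[of m] by simp
    also have "\<dots> \<le> E (Suc m) / E m * norm (X m)"
      using E_pos[of m] E_pos[of "Suc m"] c by (intro mult_left_mono) auto
    also have "\<dots> \<le> (1 - f m) * norm (X m)"
      using E[OF m] by (intro mult_right_mono) (auto simp: f_def)
    finally have "E (Suc m) * norm (Y (Suc m)) \<le> (1 - f m / 2) * norm (X m)"
      using EY_Suc[OF m] * by (simp add: algebra_simps)
    moreover have "norm (X m) \<le> exp (f m) * norm (X (Suc m))"
    proof -
      \<comment> \<open>The product equals 1 + (f - f^2)/2, hence the need for f to be at most
        1.\<close>
      have "1 \<le> (1 + f m) * (1 - f m / 2)"
        using f(2)[of m] f_le[OF m] mult_left_le[of "f m" "f m"] by (simp add: algebra_simps)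
      then have "norm (X m) \<le> (1 + f m) * ((1 - f m / 2) * norm (X m))"
        using mult_right_mono[of 1 _ "norm (X m)"] by (simp flip: mult.assoc)
      also have "\<dots> \<le> exp (f m) * norm (X (Suc m))"
        using lower f_le[OF m] f(2)[of m] by (intro mult_mono) (auto intro: exp_ge_add_one_self)
      finally show ?thesis .
    qed
    ultimately show ?thesis using lower by simp
  qed
  \<comment> \<open>Otherwise the sequence is in the cone from \<open>n\<close> on, and
    \<open>X\<close> can lose at most the factor \<open>exp (suminf f)\<close> altogether, so its
    limit could not be 0.\<close>
  have XY: "norm (X n) \<le> E n * norm (Y n)" if n: "n \<ge> N" for n
  proof (rule ccontr)
    assume "\<not> norm (X n) \<le> E n * norm (Y n)"
    then have c: "E n * norm (Y n) \<le> norm (X n)" and nz: "X n \<noteq> 0"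
      using E_pos[of n] by (auto simp: not_le) (smt (verit) mult_nonneg_nonneg norm_ge_zero)
    have in_cone: "E m * norm (Y m) \<le> norm (X m)" if "m \<ge> n" for m
      using that by (induction m rule: dec_induct) (use c cone n in auto)
    have bound: "norm (X n) \<le> norm (X m) * exp (suminf f)" if "m \<ge> n" for m
    proof -
      have "norm (X n) \<le> norm (X m) * exp (\<Sum>i=n..<m. f i)"
        using that
      proof (induction m rule: dec_induct)
        case (step m)
        have "norm (X m) \<le> exp (f m) * norm (X (Suc m))"
          using cone[of m] in_cone step.hyps n by simp
        then have "norm (X m) * exp (\<Sum>i=n..<m. f i) \<le> (exp (f m) * norm (X (Suc m))) * exp (\<Sum>i=n..<m. f i)"
          by (intro mult_right_mono) auto
        from order.trans[OF step.IH this] step.hyps show ?case by (simp add: exp_add mult_ac)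
      qed simp
      also have "\<dots> \<le> norm (X m) * exp (suminf f)"
        using sum_le_suminf[OF f(1), of "{n..<m}"] f(2) by (simp add: mult_left_mono)
      finally show ?thesis .
    qed
    have "(\<lambda>m. norm (X m) * exp (suminf f)) \<longlonglongrightarrow> norm (0::complex) * exp (suminf f)"
      by (intro tendsto_intros X)
    then have "norm (X n) \<le> norm (0::complex) * exp (suminf f)"
      by (rule LIMSEQ_le_const) (use bound in blast)
    with nz show False by simp
  qed
  \<comment> \<open>With \<open>X\<close> dominated by \<open>E\<close> times \<open>Y\<close>,
    division by \<open>E (Suc m)\<close> costs a factor 2, and the recursion for the modulus of
    \<open>Y\<close> has growth factor 1 + f.\<close>
  define g where "g n = norm (Y n)" for n
  have "g (Suc m) \<le> exp (f m) * g m" if m: "m \<ge> N" for m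
  proof -
    let ?e = "D * real m powr (-1-\<rho>)"
    have "E (Suc m) * g (Suc m) \<le> E (Suc m) * g m + ?e * (2 * (E m * g m))"
      using EY_Suc[OF m] mult_left_mono[of "norm (X m) + E m * norm (Y m)" "2 * (E m * g m)" ?e] XY[OF m] D
      by (simp add: g_def)
    also have "\<dots> \<le> E (Suc m) * g m + ?e * (2 * (2 * E (Suc m) * g m))"
      using E2[OF m] D by (intro add_left_mono mult_left_mono mult_right_mono) (auto simp: g_def)
    also have "\<dots> = E (Suc m) * ((1 + f m) * g m)" by (simp add: f_def algebra_simps)
    finally have "g (Suc m) \<le> (1 + f m) * g m" using E_pos[of "Suc m"] by simp
    also have "\<dots> \<le> exp (f m) * g m" by (intro mult_right_mono exp_ge_add_one_self) (auto simp: g_def)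
    finally show ?thesis .
  qed
  then have Y_le: "g n \<le> g N * exp (suminf f)" if "n \<ge> N" for n
    using f that by (intro gronwall_exp) (auto simp: g_def)
  have "norm (X n) + E n * norm (Y n) \<le> 2 * (g N * exp (suminf f)) * E n" if "n \<ge> N" for n
  proof -
    have "E n * norm (Y n) \<le> E n * (g N * exp (suminf f))"
      using Y_le[OF that] E_pos[of n] by (intro mult_left_mono) (auto simp: g_def)
    with XY[OF that] show ?thesis by (simp add: mult_ac)
  qed
  then show ?thesis by blast
qed

end

section \<open>Variation of constants\<close>

lemma wkb_nonzero: "n > 0 \<Longrightarrow> wkb s k n \<noteq> 0"
  by (simp add: wkb_def)

text \<open>The discrete Wronskian. It is the determinant of the linear system that expresses two
  consecutive values of a sequence through those of \<open>p\<close> and \<open>q\<close>.\<close>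

definition casorati :: "(nat \<Rightarrow> complex) \<Rightarrow> (nat \<Rightarrow> complex) \<Rightarrow> nat \<Rightarrow> complex" where
  "casorati p q n = p n * q (Suc n) - p (Suc n) * q n"

text \<open>Divided by the product of the approximants, the determinant is, up to a factor tending
  to 1, a difference of two exponentials exp(k h + ...) - exp(-k h + ...), which is 2 k h + O(h^2)
  with h = \<open>rsqrt n\<close>. Half of this main term remains as the bound.\<close>

lemma casorati_wkb_lower_bound:
  assumes "k \<noteq> 0"
  shows "\<forall>\<^sub>F n in sequentially. norm (casorati (wkb s k) (wkb s (- k)) n) \<ge>
    norm k * real n powr (-1/2) * norm (wkb s k n * wkb s (- k) n)"
proof -
  define x where "x n = sqrt (real n + 1) - sqrt (real n)" for n
  define T where "T k n = exp (2 * k * of_real (x n))" for k :: complex and n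
  define r where "r n = ((real n + 1) / real n) powr s" for n
  have T: "(\<lambda>n. T c n - (1 + c * rsqrt n)) \<in> O(\<lambda>n. rsqrt n ^ 2)" for c
  proof -
    have "(\<lambda>n. T c n - (1 + c * rsqrt n + c\<^sup>2 / 2 * rsqrt n ^ 2 + (2 * c * of_real (-1/8) + c ^ 3 / 6) * rsqrt n ^ 3)) \<in> O(\<lambda>n. rsqrt n ^ 4)"
      unfolding T_def x_def using sqrt_shift_expansions(1) by (intro exp_expansion) simp
    also have "(\<lambda>n. rsqrt n ^ 4) \<in> O(\<lambda>n. rsqrt n ^ 2)"
      using poly_rsqrt_bigo[OF tendsto_power[OF rsqrt_tendsto, of 2], of 2] by (simp flip: power_add)
    finally have 1: "(\<lambda>n. T c n - (1 + c * rsqrt n + c\<^sup>2 / 2 * rsqrt n ^ 2 + (2 * c * of_real (-1/8) + c ^ 3 / 6) * rsqrt n ^ 3)) \<in> O(\<lambda>n. rsqrt n ^ 2)" .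
    have "(\<lambda>n. rsqrt n ^ 2 * (c\<^sup>2 / 2 + (2 * c * of_real (-1/8) + c ^ 3 / 6) * rsqrt n)) \<in> O(\<lambda>n. rsqrt n ^ 2)"
      by (rule poly_rsqrt_bigo) (rule tendsto_intros rsqrt_tendsto)+
    from sum_in_bigo(1)[OF 1 this] show ?thesis
      by (simp add: algebra_simps eval_nat_numeral)
  qed
  from sum_in_bigo(2)[OF T[of k] T[of "-k"]]
  have "(\<lambda>n. T k n - T (-k) n - 2 * k * rsqrt n) \<in> O(\<lambda>n. rsqrt n ^ 2)"
    by (simp add: algebra_simps)
  then obtain c where c: "c > 0" and ev: "\<forall>\<^sub>F n in sequentially.
      norm (T k n - T (-k) n - 2 * k * rsqrt n) \<le> c * norm (rsqrt n ^ 2)"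
    by (elim landau_o.bigE)
  \<comment> \<open>From here on the quadratic error is at most a quarter of the main term 2 k h,
    which leaves 3/2 of the modulus of k h.\<close>
  have small: "\<forall>\<^sub>F n in sequentially. norm (rsqrt n) < norm k / (2 * c)"
    using assms c rsqrt_tendsto by (intro order_tendstoD[OF tendsto_norm_zero]) auto
  have r: "\<forall>\<^sub>F n in sequentially. r n > 2/3"
    unfolding r_def by (rule order_tendstoD(1)[where y = 1]) (real_asymp | simp)+
  show ?thesis
    using ev small r eventually_gt_at_top[of 0]
  proof eventually_elim
    case (elim n)
    have "c * norm (rsqrt n) \<le> norm k / 2"
      using elim(2) c by (simp add: field_simps)
    from mult_right_mono[OF this, of "norm (rsqrt n)"]
    have "norm (T k n - T (-k) n - 2 * k * rsqrt n) \<le> norm k / 2 * norm (rsqrt n)"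
      using elim(1) by (simp add: norm_mult power2_eq_square mult_ac)
    moreover have "norm (2 * k * rsqrt n) = 2 * norm k * norm (rsqrt n)" by (simp add: norm_mult)
    moreover have "norm (2 * k * rsqrt n) - norm (T k n - T (-k) n - 2 * k * rsqrt n) \<le> norm (T k n - T (-k) n)"
      using norm_triangle_ineq4[of "T k n - T (-k) n" "T k n - T (-k) n - 2 * k * rsqrt n"] by simp
    ultimately have 1: "norm (T k n - T (-k) n) \<ge> 3/2 * norm k * norm (rsqrt n)" by linarith
    \<comment> \<open>The bound 2/3 for \<open>r n\<close> was chosen to compensate the 3/2.\<close>
    have "norm k * norm (rsqrt n) = 2/3 * (3/2 * norm k * norm (rsqrt n))" by simp
    also have "\<dots> \<le> r n * norm (T k n - T (-k) n)"
      using 1 elim by (intro mult_mono) auto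
    finally have 2: "norm k * norm (rsqrt n) \<le> r n * norm (T k n - T (-k) n)" .
    have "casorati (wkb s k) (wkb s (- k)) n = - (wkb s k n * wkb s (- k) n * of_real (r n) * (T k n - T (-k) n))"
      unfolding casorati_def wkb_Suc[OF elim(4)] T_def r_def x_def by (simp add: algebra_simps)
    then have "norm (casorati (wkb s k) (wkb s (- k)) n) =
        r n * norm (T k n - T (-k) n) * norm (wkb s k n * wkb s (- k) n)"
      using elim(3) by (simp add: norm_mult norm_minus_commute)
    with mult_right_mono[OF 2, of "norm (wkb s k n * wkb s (- k) n)"] show ?case
      by (simp add: rsqrt_def)
  qed
qed

text \<open>Cramer's rule. The same two coefficients represent \<open>u\<close> at both n and n + 1,
  as variation of constants requires.\<close>

lemma casorati_decomposition:
  assumes "casorati p q n \<noteq> 0"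
  shows "u n = casorati u q n / casorati p q n * p n + casorati p u n / casorati p q n * q n"
    and "u (Suc n) = casorati u q n / casorati p q n * p (Suc n) + casorati p u n / casorati p q n * q (Suc n)"
proof -
  have "u n * casorati p q n = casorati u q n * p n + casorati p u n * q n"
    "u (Suc n) * casorati p q n = casorati u q n * p (Suc n) + casorati p u n * q (Suc n)"
    by (simp_all add: casorati_def algebra_simps)
  with assms show "u n = casorati u q n / casorati p q n * p n + casorati p u n / casorati p q n * q n"
    "u (Suc n) = casorati u q n / casorati p q n * p (Suc n) + casorati p u n / casorati p q n * q (Suc n)"
    by (simp_all add: field_simps)
qed

text \<open>The recurrence expresses \<open>A\<close> times u(n+2) as \<open>A\<close> times the
  continued combination of \<open>p\<close> and \<open>q\<close>, minus the combination of their
  residuals. Inserted into the Casorati determinants at n + 1, the combination reproduces the old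
  coefficients and only the residuals are left.\<close>

lemma variation_of_constants:
  fixes u p q :: "nat \<Rightarrow> complex" and A A' B :: complex
  defines "X \<equiv> \<lambda>n. casorati u q n / casorati p q n" and "Y \<equiv> \<lambda>n. casorati p u n / casorati p q n"
    and "rp \<equiv> \<lambda>n. A * p (Suc (Suc n)) + B * p (Suc n) + A' * p n"
    and "rq \<equiv> \<lambda>n. A * q (Suc (Suc n)) + B * q (Suc n) + A' * q n"
  assumes nz: "casorati p q n \<noteq> 0" "casorati p q (Suc n) \<noteq> 0" "A \<noteq> 0"
    and u: "A * u (Suc (Suc n)) + B * u (Suc n) + A' * u n = 0"
  shows "X (Suc n) - X n = (X n * rp n + Y n * rq n) * q (Suc n) / (A * casorati p q (Suc n))"
    and "Y (Suc n) - Y n = - ((X n * rp n + Y n * rq n) * p (Suc n) / (A * casorati p q (Suc n)))"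
proof -
  define x y where "x = X n" and "y = Y n"
  have u0: "u n = x * p n + y * q n" and u1: "u (Suc n) = x * p (Suc n) + y * q (Suc n)"
    using casorati_decomposition[OF nz(1), of u] by (simp_all add: x_def y_def X_def Y_def)
  have u2: "A * u (Suc (Suc n)) = A * (x * p (Suc (Suc n)) + y * q (Suc (Suc n))) - (x * rp n + y * rq n)"
    using u unfolding u0 u1 by (simp add: rp_def rq_def algebra_simps add_eq_0_iff2)
  have "A * casorati u q (Suc n) = A * x * casorati p q (Suc n) + (x * rp n + y * rq n) * q (Suc n)"
    "A * casorati p u (Suc n) = A * y * casorati p q (Suc n) - (x * rp n + y * rq n) * p (Suc n)"
  proof -
    have "A * casorati u q (Suc n) = A * u (Suc n) * q (Suc (Suc n)) - (A * u (Suc (Suc n))) * q (Suc n)"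
      by (simp add: casorati_def algebra_simps)
    then show "A * casorati u q (Suc n) = A * x * casorati p q (Suc n) + (x * rp n + y * rq n) * q (Suc n)"
      unfolding u2 u1 by (simp add: casorati_def algebra_simps)
    have "A * casorati p u (Suc n) = p (Suc n) * (A * u (Suc (Suc n))) - A * p (Suc (Suc n)) * u (Suc n)"
      by (simp add: casorati_def algebra_simps)
    then show "A * casorati p u (Suc n) = A * y * casorati p q (Suc n) - (x * rp n + y * rq n) * p (Suc n)"
      unfolding u2 u1 by (simp add: casorati_def algebra_simps)
  qed
  moreover have "c / casorati p q (Suc n) - v = (A * c - A * v * casorati p q (Suc n)) / (A * casorati p q (Suc n))" for c v
    using nz by (simp add: field_simps)
  ultimately show "X (Suc n) - X n = (X n * rp n + Y n * rq n) * q (Suc n) / (A * casorati p q (Suc n))"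
    and "Y (Suc n) - Y n = - ((X n * rp n + Y n * rq n) * p (Suc n) / (A * casorati p q (Suc n)))"
    unfolding x_def[symmetric] y_def[symmetric] unfolding X_def Y_def by simp_all
qed

text \<open>The weight \<open>e\<close> balances the two equations: the combined residual is at most
  r times the modulus of p(n+1) times the weighted sum of the coefficients, so \<open>X\<close> and
  the weighted \<open>Y\<close> obey the same estimate, free of the approximants.\<close>

lemma variation_of_constants_bound:
  fixes u p q :: "nat \<Rightarrow> complex" and A A' B :: complex and r w :: real
  defines "X \<equiv> \<lambda>n. casorati u q n / casorati p q n" and "Y \<equiv> \<lambda>n. casorati p u n / casorati p q n"
  assumes nz: "casorati p q n \<noteq> 0" "A \<noteq> 0" "p (Suc n) \<noteq> 0" "q (Suc n) \<noteq> 0"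
    and u: "A * u (Suc (Suc n)) + B * u (Suc n) + A' * u n = 0"
    and rp: "norm (A * p (Suc (Suc n)) + B * p (Suc n) + A' * p n) \<le> r * norm (p (Suc n))"
    and rq: "norm (A * q (Suc (Suc n)) + B * q (Suc n) + A' * q n) \<le> r * norm (q (Suc n))"
    and w: "w > 0" "norm (casorati p q (Suc n)) \<ge> w * norm (p (Suc n) * q (Suc n))"
  defines "e \<equiv> norm (q (Suc n)) / norm (p (Suc n))"
  shows "norm (X (Suc n) - X n) \<le> r / (norm A * w) * (norm (X n) + e * norm (Y n))"
    and "e * norm (Y (Suc n) - Y n) \<le> r / (norm A * w) * (norm (X n) + e * norm (Y n))"
proof -
  let ?p = "norm (p (Suc n))" and ?q = "norm (q (Suc n))"
  define G where "G = X n * (A * p (Suc (Suc n)) + B * p (Suc n) + A' * p n)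
      + Y n * (A * q (Suc (Suc n)) + B * q (Suc n) + A' * q n)"
  have pos: "?p > 0" "?q > 0" using nz by auto
  have nz': "casorati p q (Suc n) \<noteq> 0"
    using w(2) mult_pos_pos[OF w(1) mult_pos_pos[OF pos]] by (auto simp: norm_mult)
  have "norm G \<le> norm (X n) * (r * ?p) + norm (Y n) * (r * ?q)"
    unfolding G_def using rp rq by (intro norm_triangle_le add_mono) (auto simp: norm_mult intro!: mult_left_mono)
  also have "\<dots> = r * ?p * (norm (X n) + e * norm (Y n))"
    using pos by (simp add: e_def field_simps)
  finally have G: "norm G \<le> r * ?p * (norm (X n) + e * norm (Y n))" .
  have den: "norm A * (w * (?p * ?q)) \<le> norm A * norm (casorati p q (Suc n))"
    using w(2) by (intro mult_left_mono) (auto simp: norm_mult)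
  have *: "norm G * ?q / (norm A * norm (casorati p q (Suc n))) \<le>
      r * ?p * (norm (X n) + e * norm (Y n)) * ?q / (norm A * (w * (?p * ?q)))"
  proof (rule frac_le)
    show "0 \<le> r * ?p * (norm (X n) + e * norm (Y n)) * ?q"
      using order.trans[OF norm_ge_zero G] by simp
    show "norm G * ?q \<le> r * ?p * (norm (X n) + e * norm (Y n)) * ?q"
      using G by (rule mult_right_mono) simp
    show "0 < norm A * (w * (?p * ?q))"
      using pos w(1) nz(2) by simp
  qed (fact den)
  also have "\<dots> = r / (norm A * w) * (norm (X n) + e * norm (Y n))"
    using pos by simp
  finally have **: "norm G * ?q / (norm A * norm (casorati p q (Suc n))) \<le> r / (norm A * w) * (norm (X n) + e * norm (Y n))" .
  have "X (Suc n) - X n = G * q (Suc n) / (A * casorati p q (Suc n))"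
    "Y (Suc n) - Y n = - (G * p (Suc n) / (A * casorati p q (Suc n)))"
    unfolding X_def Y_def G_def by (rule variation_of_constants[OF nz(1) nz' nz(2) u])+
  then show "norm (X (Suc n) - X n) \<le> r / (norm A * w) * (norm (X n) + e * norm (Y n))"
    "e * norm (Y (Suc n) - Y n) \<le> r / (norm A * w) * (norm (X n) + e * norm (Y n))"
    using ** pos by (simp_all add: norm_mult norm_divide e_def mult_ac)
qed

section \<open>The Jacobi recurrence\<close>

lemma norm_wkb: "norm (wkb s k n) = real n powr s * exp (2 * Re k * sqrt (real n))"
  by (simp add: wkb_def norm_mult)

text \<open>Both signs of the discriminant are treated at once: \<open>k\<close> is imaginary in the
  oscillatory case and positive in the exponential one. The sign condition on \<open>Re k\<close>
  makes \<open>q\<close> the approximant that is never the larger one.\<close>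

locale jacobi_asymptotics =
  fixes a b :: "nat \<Rightarrow> real" and \<alpha> \<beta> \<gamma> \<sigma> \<nu> \<rho> :: real and k :: complex
  assumes a_pos: "\<And>n. a n > 0"
    and a_asymp: "(\<lambda>n. a n / real n powr \<sigma> - (1 + \<alpha> / real n)) \<in> O(\<lambda>n. 1 / real n ^ 2)"
    and b_asymp: "(\<lambda>n. b n / (2 * \<gamma> * real n powr \<sigma>) - (1 + \<beta> / real n)) \<in> O(\<lambda>n. 1 / real n ^ 2)"
    and gamma: "\<bar>\<gamma>\<bar> = 1" and sigma: "\<sigma> > 3 / 2"
    and nu: "\<nu> = - sgn \<gamma>" and rho: "\<rho> = min (\<sigma> - 3 / 2) (1 / 2)"
    and k_sq: "k\<^sup>2 = of_real (2 * \<beta> - 2 * \<alpha> + \<sigma>)" and k_nz: "k \<noteq> 0" and Re_k: "Re k \<ge> 0"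
begin

definition s :: real where "s = - \<sigma> / 2 + 1 / 4"
abbreviation p :: "nat \<Rightarrow> complex" where "p \<equiv> wkb s k"
abbreviation q :: "nat \<Rightarrow> complex" where "q \<equiv> wkb s (- k)"
definition u :: "nat \<Rightarrow> complex \<Rightarrow> complex" where
  "u n z = of_real (\<nu> ^ n) * poly (orth_poly a b n) z"
definition X :: "nat \<Rightarrow> complex \<Rightarrow> complex" where
  "X n z = casorati (\<lambda>n. u n z) q n / casorati p q n"
definition Y :: "nat \<Rightarrow> complex \<Rightarrow> complex" where
  "Y n z = casorati p (\<lambda>n. u n z) n / casorati p q n"
text \<open>This is the modulus of q/p for positive n, see \<open>E_eq\<close>. The closed form is
  positive and decreasing at index 0 as well, where both approximants vanish.\<close>

definition E :: "nat \<Rightarrow> real" where "E n = exp (- 4 * Re k * sqrt (real n))"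

section \<open>Sign normalisation and reduction to a perturbed diagonal system\<close>

lemma nu_cases: "\<nu> = 1 \<and> \<gamma> = -1 \<or> \<nu> = -1 \<and> \<gamma> = 1"
  using gamma nu by (auto simp: abs_if split: if_splits)

lemma nu_power_sq: "\<nu> ^ n * \<nu> ^ n = 1"
  using nu_cases by (auto simp flip: power_mult_distrib)

lemma poly_eq_u: "poly (orth_poly a b n) z = of_real (\<nu> ^ n) * u n z"
  using nu_power_sq[of n, THEN arg_cong[where f = complex_of_real]] by (simp add: u_def flip: mult.assoc)

lemma norm_poly: "norm (poly (orth_poly a b n) z) = norm (u n z)"
  using nu_cases by (auto simp: u_def norm_mult norm_power)

lemma rho_pos: "\<rho> > 0" and rho_le: "\<rho> \<le> 1 / 2" "\<rho> \<le> \<sigma> - 3 / 2"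
  using sigma by (auto simp: rho min_def)

lemma u_recurrence:
  "of_real (a (Suc n)) * u (Suc (Suc n)) z + of_real \<nu> * (of_real (b (Suc n)) - z) * u (Suc n) z
    + of_real (a n) * u n z = 0"
proof -
  have "of_real (a n) * poly (orth_poly a b n) z
           + of_real (b (Suc n)) * poly (orth_poly a b (Suc n)) z
           + of_real (a (Suc n)) * poly (orth_poly a b (Suc (Suc n))) z
           = z * poly (orth_poly a b (Suc n)) z"
    using a_pos by (rule orth_poly_recurrence)
  moreover have "of_real (a (Suc n)) * u (Suc (Suc n)) z + of_real \<nu> * (of_real (b (Suc n)) - z) * u (Suc n) z
    + of_real (a n) * u n z = of_real (\<nu> ^ n) * (of_real (a n) * poly (orth_poly a b n) z
           + of_real (b (Suc n)) * poly (orth_poly a b (Suc n)) z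
           + of_real (a (Suc n)) * poly (orth_poly a b (Suc (Suc n))) z
           - z * poly (orth_poly a b (Suc n)) z)"
  proof -
    have "\<nu> * \<nu> = 1" using nu_cases by auto
    then have v: "complex_of_real \<nu> * of_real \<nu> = 1" by (simp flip: of_real_mult)
    have 2: "u (Suc (Suc n)) z = of_real (\<nu> ^ n) * poly (orth_poly a b (Suc (Suc n))) z"
      using v by (simp add: u_def del: orth_poly.simps flip: mult.assoc)
    have "of_real \<nu> * (of_real (b (Suc n)) - z) * u (Suc n) z
        = of_real \<nu> * of_real \<nu> * ((of_real (b (Suc n)) - z) * (of_real (\<nu> ^ n) * poly (orth_poly a b (Suc n)) z))"
      by (simp add: u_def mult_ac del: orth_poly.simps)
    then show ?thesis unfolding 2 v by (simp add: u_def algebra_simps del: orth_poly.simps)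
  qed
  ultimately show ?thesis by simp
qed

lemma E_pos: "E n > 0" and E_Suc: "E (Suc n) \<le> E n"
  using Re_k by (auto simp: E_def intro!: mult_left_mono)

lemma E_eq: "n > 0 \<Longrightarrow> norm (q n) / norm (p n) = E n"
  by (simp add: norm_wkb E_def flip: exp_diff)

lemma casorati_nz: "\<forall>\<^sub>F n in sequentially. casorati p q n \<noteq> 0"
  using casorati_wkb_lower_bound[OF k_nz, of s] eventually_gt_at_top[of 0]
proof eventually_elim
  case (elim n)
  have "norm k * real n powr (-1/2) * norm (p n * q n) > 0"
    using elim(2) k_nz wkb_nonzero by simp
  with elim(1) show ?case by auto
qed

lemma residual:
  assumes "k' = k \<or> k' = - k"
  shows "\<exists>C>0. \<forall>\<^sub>F n in sequentially.
    norm (of_real (a n) * wkb s k' (Suc n) + of_real (\<nu> * b n) * wkb s k' n + of_real (a (n - 1)) * wkb s k' (n - 1))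
      \<le> C * real n powr (\<sigma> - 2) * norm (wkb s k' n)"
proof (rule wkb_residual[OF a_asymp _ _ s_def])
  \<comment> \<open>As \<open>\<gamma>\<close> is 1 or -1, \<open>\<nu>\<close> equals
    -1/\<open>\<gamma>\<close>; multiplying the expansion by -2 turns it into one for
    \<open>\<nu> * b n\<close> with leading coefficient -2.\<close>
  have "(\<lambda>n. - 2 * (b n / (2 * \<gamma> * real n powr \<sigma>) - (1 + \<beta> / real n))) \<in> O(\<lambda>n. 1 / real n ^ 2)"
    using b_asymp by (subst landau_o.big.cmult_in_iff) auto
  also have "(\<lambda>n. - 2 * (b n / (2 * \<gamma> * real n powr \<sigma>) - (1 + \<beta> / real n)))
     = (\<lambda>n. \<nu> * b n / real n powr \<sigma> + 2 * (1 + \<beta> / real n))"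
    using nu_cases by (auto simp: fun_eq_iff algebra_simps)
  finally show "(\<lambda>n. \<nu> * b n / real n powr \<sigma> + 2 * (1 + \<beta> / real n)) \<in> O(\<lambda>n. 1 / real n ^ 2)" .
qed (use assms k_sq in auto)

lemma a_lower: "\<forall>\<^sub>F n in sequentially. a n \<ge> real n powr \<sigma> / 2"
proof -
  have "(\<lambda>n. 1 / real n ^ 2) \<longlonglongrightarrow> 0" by real_asymp
  then have "(\<lambda>n. 1 / real n ^ 2) \<in> o(\<lambda>_. 1)" by (intro smalloI_tendsto) auto
  then have "(\<lambda>n. a n / real n powr \<sigma> - (1 + \<alpha> / real n)) \<in> o(\<lambda>_. 1)"
    by (rule landau_o.big_small_trans[OF a_asymp])
  then have "(\<lambda>n. a n / real n powr \<sigma> - (1 + \<alpha> / real n)) \<longlonglongrightarrow> 0"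
    by (drule_tac smalloD_tendsto) simp
  moreover have "(\<lambda>n. 1 + \<alpha> / real n) \<longlonglongrightarrow> 1" by real_asymp
  ultimately have "(\<lambda>n. (a n / real n powr \<sigma> - (1 + \<alpha> / real n)) + (1 + \<alpha> / real n)) \<longlonglongrightarrow> 0 + 1"
    by (rule tendsto_add)
  then have "(\<lambda>n. a n / real n powr \<sigma>) \<longlonglongrightarrow> 1" by simp
  then have "\<forall>\<^sub>F n in sequentially. a n / real n powr \<sigma> > 1 / 2"
    by (rule order_tendstoD) simp
  then show ?thesis
    using eventually_gt_at_top[of 0] by eventually_elim (simp add: field_simps)
qed

text \<open>The residuals contribute n^(\<open>\<sigma>\<close>-2) and the spectral parameter a
  constant. Division by \<open>a\<close>, of order n^\<open>\<sigma>\<close>, and by the Casorati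
  factor n^(-1/2) gives n^(-3/2) and n^(1/2-\<open>\<sigma>\<close>), both at most
  n^(-1-\<open>\<rho>\<close>): the first yields the bound 1/2 on \<open>\<rho>\<close>, the second
  the bound \<open>\<sigma>\<close> - 3/2. The constants depend on z only through
  \<open>Z\<close>.\<close>

lemma perturbed:
  assumes "Z \<ge> 0"
  shows "\<exists>D N0. \<forall>N\<ge>N0. \<forall>z. norm z \<le> Z \<longrightarrow> perturbed_system (\<lambda>n. X n z) (\<lambda>n. Y n z) E D \<rho> N"
proof -
  define res where "res k' n =
    of_real (a n) * wkb s k' (Suc n) + of_real (\<nu> * b n) * wkb s k' n + of_real (a (n - 1)) * wkb s k' (n - 1)" for k' n
  obtain C1 where C1: "C1 > 0" "\<forall>\<^sub>F n in sequentially. norm (res k n) \<le> C1 * real n powr (\<sigma> - 2) * norm (wkb s k n)"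
    unfolding res_def using residual[of k] by blast
  obtain C2 where C2: "C2 > 0" "\<forall>\<^sub>F n in sequentially. norm (res (- k) n) \<le> C2 * real n powr (\<sigma> - 2) * norm (wkb s (- k) n)"
    unfolding res_def using residual[of "- k"] by blast
  define C where "C = max C1 C2"
  have "\<forall>\<^sub>F n in sequentially. norm (res k n) \<le> C1 * real n powr (\<sigma> - 2) * norm (wkb s k n) \<and>
      norm (res (- k) n) \<le> C2 * real n powr (\<sigma> - 2) * norm (wkb s (- k) n) \<and>
      norm (casorati p q n) \<ge> norm k * real n powr (-1/2) * norm (p n * q n) \<and>
      casorati p q n \<noteq> 0 \<and> a n \<ge> real n powr \<sigma> / 2"
    by (intro eventually_conj C1 C2 casorati_nz a_lower casorati_wkb_lower_bound k_nz)
  then obtain N1 where N1: "\<And>n. n \<ge> N1 \<Longrightarrow> norm (res k n) \<le> C1 * real n powr (\<sigma> - 2) * norm (wkb s k n) \<and>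
      norm (res (- k) n) \<le> C2 * real n powr (\<sigma> - 2) * norm (wkb s (- k) n) \<and>
      norm (casorati p q n) \<ge> norm k * real n powr (-1/2) * norm (p n * q n) \<and>
      casorati p q n \<noteq> 0 \<and> a n \<ge> real n powr \<sigma> / 2"
    by (auto simp: eventually_sequentially)
  define N0 where "N0 = max N1 1"
  \<comment> \<open>The 2 comes from the lower bound for \<open>a\<close>, the denominator from that
    for the Casorati determinant.\<close>
  define D where "D = 2 * (C + Z) / norm k"
  have D: "D \<ge> 0" using C1(1) assms by (simp add: D_def C_def)
  have "norm (X (Suc n) z - X n z) \<le> D * real n powr (-1-\<rho>) * (norm (X n z) + E n * norm (Y n z)) \<and>
      E (Suc n) * norm (Y (Suc n) z - Y n z) \<le> D * real n powr (-1-\<rho>) * (norm (X n z) + E n * norm (Y n z))"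
    if n: "n \<ge> N0" and z: "norm z \<le> Z" for n z
  proof -
    define t where "t = real (Suc n)"
    have t: "t \<ge> 1" by (simp add: t_def)
    define r where "r = (C + Z) * t powr (\<sigma> - \<rho> - 3/2)"
    define B where "B = of_real \<nu> * (of_real (b (Suc n)) - z)"
    have "Suc n \<ge> N1" using n by (simp add: N0_def)
    from N1[OF this, folded t_def]
    have res: "norm (res k (Suc n)) \<le> C1 * t powr (\<sigma> - 2) * norm (p (Suc n))"
        "norm (res (- k) (Suc n)) \<le> C2 * t powr (\<sigma> - 2) * norm (q (Suc n))"
      and cas: "norm (casorati p q (Suc n)) \<ge> norm k * t powr (-1/2) * norm (p (Suc n) * q (Suc n))"
      and a: "a (Suc n) \<ge> t powr \<sigma> / 2"
      by simp_all
    have r: "norm (of_real (a (Suc n)) * wkb s k' (Suc (Suc n)) + B * wkb s k' (Suc n) + of_real (a n) * wkb s k' n)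
        \<le> r * norm (wkb s k' (Suc n))"
      if le: "norm (res k' (Suc n)) \<le> C' * t powr (\<sigma> - 2) * norm (wkb s k' (Suc n))" and C': "C' \<le> C" "C' > 0" for k' C'
    proof -
      have "of_real (a (Suc n)) * wkb s k' (Suc (Suc n)) + B * wkb s k' (Suc n) + of_real (a n) * wkb s k' n
         = res k' (Suc n) - of_real \<nu> * z * wkb s k' (Suc n)"
        by (simp add: res_def B_def algebra_simps)
      also have "norm \<dots> \<le> norm (res k' (Suc n)) + norm (of_real \<nu> * z * wkb s k' (Suc n))"
        by (rule norm_triangle_ineq4)
      also have "norm (of_real \<nu> * z * wkb s k' (Suc n)) = norm z * norm (wkb s k' (Suc n))"
        using nu_cases by (auto simp: norm_mult)
      also have "norm (res k' (Suc n)) + norm z * norm (wkb s k' (Suc n)) \<le>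
          (C' * t powr (\<sigma> - 2) + norm z) * norm (wkb s k' (Suc n))"
        using le by (simp add: algebra_simps)
      also have "\<dots> \<le> r * norm (wkb s k' (Suc n))"
      proof (rule mult_right_mono)
        have "t powr (\<sigma> - 2) \<le> t powr (\<sigma> - \<rho> - 3/2)"
          using t rho_le by (intro powr_mono) auto
        moreover have "1 \<le> t powr (\<sigma> - \<rho> - 3/2)"
          using t rho_le by (intro ge_one_powr_ge_zero) auto
        ultimately have "C' * t powr (\<sigma> - 2) \<le> C * t powr (\<sigma> - \<rho> - 3/2)"
            "norm z * 1 \<le> Z * t powr (\<sigma> - \<rho> - 3/2)"
          using C' z assms by (intro mult_mono; simp)+
        then show "C' * t powr (\<sigma> - 2) + norm z \<le> r" by (simp add: r_def algebra_simps)
      qed simp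
      finally show ?thesis .
    qed
    define w where "w = norm k * t powr (-1/2)"
    define e where "e = r / (norm (complex_of_real (a (Suc n))) * w)"
    have bounds: "norm (X (Suc n) z - X n z) \<le> e * (norm (X n z) + norm (q (Suc n)) / norm (p (Suc n)) * norm (Y n z))"
      "norm (q (Suc n)) / norm (p (Suc n)) * norm (Y (Suc n) z - Y n z) \<le>
         e * (norm (X n z) + norm (q (Suc n)) / norm (p (Suc n)) * norm (Y n z))"
    proof -
      have 1: "casorati p q n \<noteq> 0" using N1[of n] n by (simp add: N0_def)
      have 2: "complex_of_real (a (Suc n)) \<noteq> 0" using a_pos[of "Suc n"] by simp
      have 3: "of_real (a (Suc n)) * u (Suc (Suc n)) z + B * u (Suc n) z + of_real (a n) * u n z = 0"
        unfolding B_def by (rule u_recurrence)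
      have 4: "norm (of_real (a (Suc n)) * p (Suc (Suc n)) + B * p (Suc n) + of_real (a n) * p n) \<le> r * norm (p (Suc n))"
        by (rule r[OF res(1)]) (simp_all add: C_def C1)
      have 5: "norm (of_real (a (Suc n)) * q (Suc (Suc n)) + B * q (Suc n) + of_real (a n) * q n) \<le> r * norm (q (Suc n))"
        by (rule r[OF res(2)]) (simp_all add: C_def C2)
      have 6: "w > 0" using k_nz t by (simp add: w_def)
      have 7: "norm (casorati p q (Suc n)) \<ge> w * norm (p (Suc n) * q (Suc n))"
        using cas by (simp add: w_def)
      from variation_of_constants_bound[OF 1 2 wkb_nonzero[OF zero_less_Suc] wkb_nonzero[OF zero_less_Suc],
          where u = "\<lambda>n. u n z", OF 3 4 5 6 7]
      show "norm (X (Suc n) z - X n z) \<le> e * (norm (X n z) + norm (q (Suc n)) / norm (p (Suc n)) * norm (Y n z))"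
      "norm (q (Suc n)) / norm (p (Suc n)) * norm (Y (Suc n) z - Y n z) \<le>
         e * (norm (X n z) + norm (q (Suc n)) / norm (p (Suc n)) * norm (Y n z))"
        unfolding X_def Y_def e_def .
    qed
    have "e \<le> r / (t powr \<sigma> / 2 * w)"
    proof -
      have "r \<ge> 0" using assms C1(1) by (simp add: r_def C_def)
      moreover have "w > 0" using k_nz t by (simp add: w_def)
      ultimately show ?thesis
        unfolding e_def using a t a_pos[of "Suc n"]
        by (intro divide_left_mono mult_right_mono mult_pos_pos) simp_all
    qed
    also have "\<dots> = D * t powr (-1-\<rho>)"
    proof -
      have "t powr (\<sigma> - \<rho> - 3/2) = t powr (-1-\<rho>) * t powr \<sigma> * t powr (-1/2)"
        by (simp flip: powr_add)
      then show ?thesis using t k_nz by (simp add: r_def w_def D_def)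
    qed
    also have "\<dots> \<le> D * real n powr (-1-\<rho>)"
      using n rho_pos D by (intro mult_left_mono powr_mono2') (auto simp: t_def N0_def)
    finally have e: "e \<le> D * real n powr (-1-\<rho>)" .
    \<comment> \<open>Variation of constants produces the quotient at n + 1; on the right it is
      enlarged to \<open>E n\<close>, on the left \<open>E (Suc n)\<close> stays.\<close>
    have "norm (X n z) + E (Suc n) * norm (Y n z) \<le> norm (X n z) + E n * norm (Y n z)"
      using E_Suc[of n] by (simp add: mult_right_mono)
    then have "e * (norm (X n z) + E (Suc n) * norm (Y n z)) \<le>
        D * real n powr (-1-\<rho>) * (norm (X n z) + E n * norm (Y n z))"
      using e D E_pos[of "Suc n"] by (intro mult_mono) auto
    with bounds show ?thesis unfolding E_eq[OF zero_less_Suc] by linarith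
  qed
  then have "\<forall>N\<ge>N0. \<forall>z. norm z \<le> Z \<longrightarrow> perturbed_system (\<lambda>n. X n z) (\<lambda>n. Y n z) E D \<rho> N"
    by (intro allI impI perturbed_system.intro D rho_pos E_pos E_Suc; blast intro: order.trans)
  then show ?thesis by blast
qed

section \<open>Limits of the coefficients, uniformly on compact sets\<close>

lemma continuous_on_X: "continuous_on K (X n)" and continuous_on_Y: "continuous_on K (Y n)"
  unfolding X_def[abs_def] Y_def[abs_def] casorati_def u_def divide_inverse
  by (intro continuous_intros continuous_on_poly)+

text \<open>For fixed index the coefficients are continuous in z, so the a priori bound at
  \<open>N\<close> has a maximum over the compact set. \<open>D\<close> is fixed before
  \<open>N\<close>, because the threshold beyond which the contraction of \<open>E\<close> wins may
  depend on \<open>D\<close>.\<close>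

lemma uniform_control:
  assumes "compact K"
  obtains D where "\<forall>N1. \<exists>N\<ge>N1. \<exists>M. (\<forall>z\<in>K. perturbed_system (\<lambda>n. X n z) (\<lambda>n. Y n z) E D \<rho> N) \<and>
    (\<forall>z\<in>K. \<forall>n\<ge>N. norm (X n z) + E n * norm (Y n z) \<le> M)"
proof -
  obtain Z where Z: "Z > 0" "\<And>z. z \<in> K \<Longrightarrow> norm z \<le> Z"
    using compact_imp_bounded[OF assms] by (auto simp: bounded_pos)
  obtain D N0 where DN: "\<And>N z. N \<ge> N0 \<Longrightarrow> norm z \<le> Z \<Longrightarrow> perturbed_system (\<lambda>n. X n z) (\<lambda>n. Y n z) E D \<rho> N"
    using perturbed[OF less_imp_le[OF Z(1)]] by blast
  show thesis
  proof (rule that[of D], rule allI)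
    fix N1
    define N where "N = max N0 N1"
    define f where "f z = (norm (X N z) + E N * norm (Y N z)) * exp (2 * D * (\<Sum>n. real n powr (-1-\<rho>)))" for z
    have "continuous_on K f"
      unfolding f_def by (intro continuous_intros continuous_on_X continuous_on_Y)
    then have "bounded (f ` K)"
      using assms compact_continuous_image compact_imp_bounded by blast
    then obtain M where M: "\<And>z. z \<in> K \<Longrightarrow> norm (f z) \<le> M"
      by (auto simp: bounded_iff)
    have ps: "perturbed_system (\<lambda>n. X n z) (\<lambda>n. Y n z) E D \<rho> N" if "z \<in> K" for z
      by (rule DN[OF _ Z(2)[OF that]]) (simp add: N_def)
    have "norm (X n z) + E n * norm (Y n z) \<le> M" if "z \<in> K" "n \<ge> N" for z n
    proof -
      have "norm (X n z) + E n * norm (Y n z) \<le> f z"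
        unfolding f_def by (rule perturbed_system.bounded[OF ps[OF that(1)] that(2)])
      also have "\<dots> \<le> M" using M[OF that(1)] by simp
      finally show ?thesis .
    qed
    with ps show "\<exists>N\<ge>N1. \<exists>M. (\<forall>z\<in>K. perturbed_system (\<lambda>n. X n z) (\<lambda>n. Y n z) E D \<rho> N) \<and>
        (\<forall>z\<in>K. \<forall>n\<ge>N. norm (X n z) + E n * norm (Y n z) \<le> M)"
      by (intro exI[of _ N] exI[of _ M] conjI ballI allI impI) (simp_all add: N_def)
  qed
qed

lemma u_decomposition:
  "\<forall>\<^sub>F n in sequentially. \<forall>z. u n z = X n z * p n + Y n z * q n"
  using casorati_nz unfolding X_def Y_def by eventually_elim (intro allI casorati_decomposition(1))

lemma X_limit_uniform:
  assumes "compact K"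
  shows "\<forall>z\<in>K. convergent (\<lambda>n. X n z)"
    and "\<exists>C. \<forall>\<^sub>F n in sequentially. \<forall>z\<in>K. norm (X n z - lim (\<lambda>n. X n z)) \<le> C * real n powr (-\<rho>)"
proof -
  obtain D where D: "\<forall>N1. \<exists>N\<ge>N1. \<exists>M. (\<forall>z\<in>K. perturbed_system (\<lambda>n. X n z) (\<lambda>n. Y n z) E D \<rho> N) \<and>
    (\<forall>z\<in>K. \<forall>n\<ge>N. norm (X n z) + E n * norm (Y n z) \<le> M)"
    by (rule uniform_control[OF assms(1)])
  obtain N1 where N1: "\<And>n. n \<ge> N1 \<Longrightarrow>
      real n powr (-1-\<rho>) \<le> 2/\<rho> * (real n powr (-\<rho>) - real (Suc n) powr (-\<rho>))"
    using powr_telescope[OF rho_pos] by (auto simp: eventually_sequentially)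
  obtain N M where N: "N \<ge> N1" and ps: "\<And>z. z \<in> K \<Longrightarrow> perturbed_system (\<lambda>n. X n z) (\<lambda>n. Y n z) E D \<rho> N"
    and M: "\<And>z n. z \<in> K \<Longrightarrow> n \<ge> N \<Longrightarrow> norm (X n z) + E n * norm (Y n z) \<le> M"
    using D[THEN spec, of "N1"] by (elim exE conjE) (rule that; blast)
  note N1 = N1[OF order.trans[OF N]]
  have *: "convergent (\<lambda>n. X n z)"
      "n \<ge> N \<Longrightarrow> norm (X n z - lim (\<lambda>n. X n z)) \<le> 2 * D * M / \<rho> * real n powr (-\<rho>)" if "z \<in> K" for z n
    using perturbed_system.X_limit[OF ps[OF that] M[OF that] N1] by blast+
  then show "\<forall>z\<in>K. convergent (\<lambda>n. X n z)" by blast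
  show "\<exists>C. \<forall>\<^sub>F n in sequentially. \<forall>z\<in>K. norm (X n z - lim (\<lambda>n. X n z)) \<le> C * real n powr (-\<rho>)"
    by (intro exI[of _ "2 * D * M / \<rho>"] eventually_sequentiallyI[of N] ballI *)
qed

lemma Y_limit_uniform:
  assumes "compact K" and "Re k = 0"
  shows "\<exists>C. \<forall>\<^sub>F n in sequentially. \<forall>z\<in>K. norm (Y n z - lim (\<lambda>n. Y n z)) \<le> C * real n powr (-\<rho>)"
proof -
  have E1: "E n = 1" for n by (simp add: E_def assms)
  obtain D where D: "\<forall>N1. \<exists>N\<ge>N1. \<exists>M. (\<forall>z\<in>K. perturbed_system (\<lambda>n. X n z) (\<lambda>n. Y n z) E D \<rho> N) \<and>
    (\<forall>z\<in>K. \<forall>n\<ge>N. norm (X n z) + E n * norm (Y n z) \<le> M)"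
    by (rule uniform_control[OF assms(1)])
  obtain N1 where N1: "\<And>n. n \<ge> N1 \<Longrightarrow>
      real n powr (-1-\<rho>) \<le> 2/\<rho> * (real n powr (-\<rho>) - real (Suc n) powr (-\<rho>))"
    using powr_telescope[OF rho_pos] by (auto simp: eventually_sequentially)
  obtain N M where N: "N \<ge> N1" and ps: "\<And>z. z \<in> K \<Longrightarrow> perturbed_system (\<lambda>n. X n z) (\<lambda>n. Y n z) E D \<rho> N"
    and M: "\<And>z n. z \<in> K \<Longrightarrow> n \<ge> N \<Longrightarrow> norm (X n z) + E n * norm (Y n z) \<le> M"
    using D[THEN spec, of "N1"] by (elim exE conjE) (rule that; blast)
  note N1 = N1[OF order.trans[OF N]]
  have *: "norm (Y n z - lim (\<lambda>n. Y n z)) \<le> 2 * D * M / \<rho> * real n powr (-\<rho>)"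
    if "z \<in> K" "n \<ge> N" for z n
  proof -
    interpret XY: perturbed_system "\<lambda>n. X n z" "\<lambda>n. Y n z" E D \<rho> N by (rule ps[OF that(1)])
    \<comment> \<open>With \<open>E\<close> constant 1 the system is symmetric in its two unknowns,
      so the limit lemma for \<open>X\<close> applies to \<open>Y\<close>.\<close>
    have "perturbed_system (\<lambda>n. Y n z) (\<lambda>n. X n z) E D \<rho> N"
      using XY.X_Suc XY.Y_Suc XY.D rho_pos by unfold_locales (simp_all add: E1 add.commute)
    from perturbed_system.X_limit(2)[OF this _ N1 that(2), of M] show ?thesis
      using M[OF that(1)] by (simp add: E1 add.commute)
  qed
  show ?thesis
    by (intro exI[of _ "2 * D * M / \<rho>"] eventually_sequentiallyI[of N] ballI *)
qed

lemma EY_uniform: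
  assumes "compact K" and "Re k > 0"
  shows "\<exists>C. \<forall>\<^sub>F n in sequentially. \<forall>z\<in>K. E n * norm (Y n z) \<le> C * real n powr (-\<rho>)"
proof -
  obtain D where D: "\<forall>N1. \<exists>N\<ge>N1. \<exists>M. (\<forall>z\<in>K. perturbed_system (\<lambda>n. X n z) (\<lambda>n. Y n z) E D \<rho> N) \<and>
    (\<forall>z\<in>K. \<forall>n\<ge>N. norm (X n z) + E n * norm (Y n z) \<le> M)"
    by (rule uniform_control[OF assms(1)])
  have "\<forall>\<^sub>F n in sequentially.
      exp (- 4 * Re k * sqrt (real (Suc n))) / exp (- 4 * Re k * sqrt (real n)) * real n powr (-\<rho>) + real n powr (-1-\<rho>)
        \<le> real (Suc n) powr (-\<rho>)"
    \<comment> \<open>The quotient of exponentials is 1 - 2 Re k n^(-1/2) + ..., whereas the loss of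
      n^(-\<open>\<rho>\<close>) and the forcing are only of relative order 1/n.\<close>
    unfolding exp_diff[symmetric] using rho_pos rho_le(1) assms(2) by real_asymp
  then obtain N1 where N1: "\<And>n. n \<ge> N1 \<Longrightarrow>
      E (Suc n) / E n * real n powr (-\<rho>) + real n powr (-1-\<rho>) \<le> real (Suc n) powr (-\<rho>)"
    by (auto simp: eventually_sequentially E_def)
  obtain N M where N: "N \<ge> max 1 N1" and ps: "\<And>z. z \<in> K \<Longrightarrow> perturbed_system (\<lambda>n. X n z) (\<lambda>n. Y n z) E D \<rho> N"
    and M: "\<And>z n. z \<in> K \<Longrightarrow> n \<ge> N \<Longrightarrow> norm (X n z) + E n * norm (Y n z) \<le> M"
    using D[THEN spec, of "max 1 N1"] by (elim exE conjE) (rule that; blast)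
  note N1 = N1[OF order.trans[OF order.trans[OF max.cobounded2 N]]]
  have "E n * norm (Y n z) \<le> (D * M + M * real N powr \<rho>) * real n powr (-\<rho>)" if "z \<in> K" "n \<ge> N" for z n
    by (rule perturbed_system.EY_decay[OF ps[OF that(1)] M[OF that(1)] _ N1 that(2)]) (use N in auto)
  then show ?thesis
    by (intro exI[of _ "D * M + M * real N powr \<rho>"] eventually_sequentiallyI[of N] ballI)
qed

text \<open>No uniformity in z is needed for identifying the zeros of the limit, so the compact set
  is a single point.\<close>

lemma recessive_if_lim_zero:
  assumes "Re k > 0" and "lim (\<lambda>n. X n z) = 0"
  shows "\<exists>C. \<forall>\<^sub>F n in sequentially. norm (u n z) \<le> C * norm (q n)"
proof -
  obtain D where D: "\<forall>N1. \<exists>N\<ge>N1. \<exists>M. (\<forall>z\<in>{z}. perturbed_system (\<lambda>n. X n z) (\<lambda>n. Y n z) E D \<rho> N) \<and>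
    (\<forall>z\<in>{z}. \<forall>n\<ge>N. norm (X n z) + E n * norm (Y n z) \<le> M)"
    by (rule uniform_control[OF compact_insert[OF compact_empty]])
  have "\<forall>\<^sub>F n in sequentially.
      exp (- 4 * Re k * sqrt (real (Suc n))) / exp (- 4 * Re k * sqrt (real n)) + 4 * D * real n powr (-1-\<rho>) \<le> 1"
    \<comment> \<open>The gap 2 Re k n^(-1/2) left by the quotient exceeds any multiple of
      n^(-1-\<open>\<rho>\<close>).\<close>
    unfolding exp_diff[symmetric] using rho_pos rho_le(1) assms(1) by real_asymp
  moreover have "\<forall>\<^sub>F n in sequentially.
      exp (- 4 * Re k * sqrt (real n)) / exp (- 4 * Re k * sqrt (real (Suc n))) \<le> 2"
    unfolding exp_diff[symmetric] using assms(1) by real_asymp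
  ultimately have "\<forall>\<^sub>F n in sequentially. E (Suc n) / E n + 4 * D * real n powr (-1-\<rho>) \<le> 1 \<and> E n \<le> 2 * E (Suc n)"
    by eventually_elim (simp add: E_def field_simps)
  then obtain N1 where N1: "\<And>n. n \<ge> N1 \<Longrightarrow> E (Suc n) / E n + 4 * D * real n powr (-1-\<rho>) \<le> 1"
    "\<And>n. n \<ge> N1 \<Longrightarrow> E n \<le> 2 * E (Suc n)"
    unfolding eventually_sequentially by blast
  obtain N where N: "N \<ge> N1" and ps: "perturbed_system (\<lambda>n. X n z) (\<lambda>n. Y n z) E D \<rho> N"
    using D[THEN spec, of N1] by blast
  have "(\<lambda>n. X n z) \<longlonglongrightarrow> 0"
    using X_limit_uniform(1)[of "{z}"] assms(2) by (simp add: convergent_LIMSEQ_iff)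
  then obtain C where C: "\<And>n. n \<ge> N \<Longrightarrow> norm (X n z) + E n * norm (Y n z) \<le> C * E n"
    using perturbed_system.recessive_if_X_null[OF ps _ N1[OF order.trans[OF N]]] by blast
  have "\<forall>\<^sub>F n in sequentially. norm (u n z) \<le> C * norm (q n)"
    using u_decomposition eventually_ge_at_top[of N] eventually_gt_at_top[of 0]
  proof eventually_elim
    case (elim n)
    have q: "norm (q n) = E n * norm (p n)"
      using E_eq[OF elim(3)] wkb_nonzero[OF elim(3)] by (simp add: field_simps)
    have "norm (u n z) \<le> norm (X n z) * norm (p n) + norm (Y n z) * norm (q n)"
      using elim(1) by (metis norm_mult norm_triangle_ineq)
    also have "\<dots> = (norm (X n z) + E n * norm (Y n z)) * norm (p n)"
      by (simp add: q algebra_simps)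
    also have "\<dots> \<le> C * E n * norm (p n)"
      using C[OF elim(2)] by (intro mult_right_mono) auto
    finally show ?case by (simp add: q)
  qed
  then show ?thesis by blast
qed

section \<open>From the coefficients to the solution\<close>

lemma oscillatory_asymptotics:
  assumes "Re k = 0" "compact K"
  shows "\<exists>C. \<forall>\<^sub>F n in sequentially. \<forall>z\<in>K.
    norm (u n z / of_real (real n powr s) - (lim (\<lambda>n. X n z) * exp (2 * k * of_real (sqrt (real n)))
      + lim (\<lambda>n. Y n z) * exp (- 2 * k * of_real (sqrt (real n))))) \<le> C * real n powr (-\<rho>)"
proof -
  obtain C1 where C1: "\<forall>\<^sub>F n in sequentially. \<forall>z\<in>K. norm (X n z - lim (\<lambda>n. X n z)) \<le> C1 * real n powr (-\<rho>)"
    using X_limit_uniform(2)[OF assms(2)] by blast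
  obtain C2 where C2: "\<forall>\<^sub>F n in sequentially. \<forall>z\<in>K. norm (Y n z - lim (\<lambda>n. Y n z)) \<le> C2 * real n powr (-\<rho>)"
    using Y_limit_uniform[OF assms(2,1)] by blast
  have "\<forall>\<^sub>F n in sequentially. \<forall>z\<in>K.
    norm (u n z / of_real (real n powr s) - (lim (\<lambda>n. X n z) * exp (2 * k * of_real (sqrt (real n)))
      + lim (\<lambda>n. Y n z) * exp (- 2 * k * of_real (sqrt (real n))))) \<le> (C1 + C2) * real n powr (-\<rho>)"
    using C1 C2 u_decomposition eventually_gt_at_top[of 0]
  proof eventually_elim
    case (elim n)
    show ?case
    proof
      fix z assume z: "z \<in> K"
      define e where "e = exp (2 * k * of_real (sqrt (real n)))"
      define e' where "e' = exp (- 2 * k * of_real (sqrt (real n)))"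
      \<comment> \<open>For imaginary \<open>k\<close> the exponentials have modulus one, so the
        errors of both coefficients carry over unchanged.\<close>
      have [simp]: "norm e = 1" "norm e' = 1" using assms(1) by (simp_all add: e_def e'_def)
      have "p n = of_real (real n powr s) * e" "q n = of_real (real n powr s) * e'"
        by (simp_all add: wkb_def e_def e'_def)
      then have "u n z / of_real (real n powr s) = X n z * e + Y n z * e'"
        using elim by (simp add: field_simps)
      then have "norm (u n z / of_real (real n powr s) - (lim (\<lambda>n. X n z) * e + lim (\<lambda>n. Y n z) * e'))
        = norm ((X n z - lim (\<lambda>n. X n z)) * e + (Y n z - lim (\<lambda>n. Y n z)) * e')"
        by (intro arg_cong[where f = norm]) (simp add: algebra_simps)
      also have "\<dots> \<le> norm (X n z - lim (\<lambda>n. X n z)) + norm (Y n z - lim (\<lambda>n. Y n z))"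
        by (rule norm_triangle_le) (simp add: norm_mult)
      also have "\<dots> \<le> (C1 + C2) * real n powr (-\<rho>)"
        using add_mono[OF bspec[OF elim(1) z] bspec[OF elim(2) z]] by (simp only: distrib_right)
      finally show "norm (u n z / of_real (real n powr s) - (lim (\<lambda>n. X n z) * exp (2 * k * of_real (sqrt (real n)))
      + lim (\<lambda>n. Y n z) * exp (- 2 * k * of_real (sqrt (real n))))) \<le> (C1 + C2) * real n powr (-\<rho>)"
        unfolding e_def e'_def .
    qed
  qed
  then show ?thesis by blast
qed

text \<open>The quotient u/p equals X + Y q/p. The second term is small by
  \<open>EY_uniform\<close>, although \<open>Y\<close> itself need not converge.\<close>

lemma dominant_asymptotics:
  assumes "Re k > 0" "compact K"
  shows "\<exists>C. \<forall>\<^sub>F n in sequentially. \<forall>z\<in>K. norm (u n z / p n - lim (\<lambda>n. X n z)) \<le> C * real n powr (-\<rho>)"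
proof -
  obtain C1 where C1: "\<forall>\<^sub>F n in sequentially. \<forall>z\<in>K. norm (X n z - lim (\<lambda>n. X n z)) \<le> C1 * real n powr (-\<rho>)"
    using X_limit_uniform(2)[OF assms(2)] by blast
  obtain C2 where C2: "\<forall>\<^sub>F n in sequentially. \<forall>z\<in>K. E n * norm (Y n z) \<le> C2 * real n powr (-\<rho>)"
    using EY_uniform[OF assms(2,1)] by blast
  have "\<forall>\<^sub>F n in sequentially. \<forall>z\<in>K. norm (u n z / p n - lim (\<lambda>n. X n z)) \<le> (C1 + C2) * real n powr (-\<rho>)"
    using C1 C2 u_decomposition eventually_gt_at_top[of 0]
  proof eventually_elim
    case (elim n)
    show ?case
    proof
      fix z assume z: "z \<in> K"
      have "norm (u n z / p n - lim (\<lambda>n. X n z)) = norm ((X n z - lim (\<lambda>n. X n z)) + Y n z * (q n / p n))"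
        using elim(3) wkb_nonzero[OF elim(4)] by (intro arg_cong[where f = norm]) (simp add: field_simps)
      also have "\<dots> \<le> norm (X n z - lim (\<lambda>n. X n z)) + E n * norm (Y n z)"
      proof (rule norm_triangle_le)
        have "norm (q n / p n) = E n" using E_eq[OF elim(4)] by (simp add: norm_divide)
        then show "norm (X n z - lim (\<lambda>n. X n z)) + norm (Y n z * (q n / p n)) \<le>
            norm (X n z - lim (\<lambda>n. X n z)) + E n * norm (Y n z)"
          unfolding norm_mult by (simp only: mult.commute order_refl)
      qed
      also have "\<dots> \<le> (C1 + C2) * real n powr (-\<rho>)"
        using add_mono[OF bspec[OF elim(1) z] bspec[OF elim(2) z]] by (simp only: distrib_right)
      finally show "norm (u n z / p n - lim (\<lambda>n. X n z)) \<le> (C1 + C2) * real n powr (-\<rho>)" .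
    qed
  qed
  then show ?thesis by blast
qed

text \<open>Serves to bound the reciprocal of the limit on compact sets free of zeros, which turns
  an absolute error into a relative one.\<close>

lemma continuous_on_lim_X:
  assumes "compact K"
  shows "continuous_on K (\<lambda>z. lim (\<lambda>n. X n z))"
proof (rule uniform_limit_theorem[where F = sequentially])
  obtain C where C: "\<forall>\<^sub>F n in sequentially. \<forall>z\<in>K. norm (X n z - lim (\<lambda>n. X n z)) \<le> C * real n powr (-\<rho>)"
    using X_limit_uniform(2)[OF assms] by blast
  have "(\<lambda>n. real n powr (-\<rho>)) \<longlonglongrightarrow> 0" using rho_pos by real_asymp
  from tendsto_mult[OF tendsto_const this, of C] have lim: "(\<lambda>n. C * real n powr (-\<rho>)) \<longlonglongrightarrow> 0" by simp
  show "uniform_limit K (\<lambda>n z. X n z) (\<lambda>z. lim (\<lambda>n. X n z)) sequentially"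
  proof (rule uniform_limitI)
    fix e :: real assume "e > 0"
    with lim have "\<forall>\<^sub>F n in sequentially. C * real n powr (-\<rho>) < e" by (rule order_tendstoD)
    with C show "\<forall>\<^sub>F n in sequentially. \<forall>z\<in>K. dist (X n z) (lim (\<lambda>n. X n z)) < e"
      by eventually_elim (auto simp: dist_norm)
  qed
  show "\<forall>\<^sub>F n in sequentially. continuous_on K (X n)"
    by (simp add: continuous_on_X)
qed simp

text \<open>If the limit vanishes, the solution is bounded by a multiple of the exponentially
  decaying \<open>q\<close> and is square summable. Conversely, square summability makes u tend to 0
  while \<open>p\<close> grows without bound, so u/p, whose limit is that of \<open>X\<close>, tends
  to 0.\<close>

lemma lim_X_eq_0_iff:
  assumes "Re k > 0"
  shows "lim (\<lambda>n. X n z) = 0 \<longleftrightarrow> z \<in> jacobi_eigenvalues a b"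
proof
  assume "lim (\<lambda>n. X n z) = 0"
  from recessive_if_lim_zero[OF assms this] obtain C where
    C: "\<forall>\<^sub>F n in sequentially. norm (u n z) \<le> C * norm (q n)" by blast
  have "(\<lambda>n. (norm (poly (orth_poly a b n) z))\<^sup>2) \<in> O(\<lambda>n. (norm (q n))\<^sup>2)"
    using C by (intro landau_o.big_power bigoI[where c = C]) (simp add: norm_poly)
  \<comment> \<open>The power n^(-2) is just a convenient summable majorant of the exponential
    decay.\<close>
  also have "(\<lambda>n. (norm (q n))\<^sup>2) \<in> O(\<lambda>n. real n powr (-2))"
    unfolding norm_wkb using assms by simp real_asymp
  finally have "summable (\<lambda>n. (norm (poly (orth_poly a b n) z))\<^sup>2)"
    by (rule summable_comparison_test_bigo[rotated]) (simp add: summable_real_powr_iff)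
  then show "z \<in> jacobi_eigenvalues a b" by (simp add: jacobi_eigenvalues_def)
next
  assume "z \<in> jacobi_eigenvalues a b"
  then have "summable (\<lambda>n. (norm (poly (orth_poly a b n) z))\<^sup>2)"
    by (simp add: jacobi_eigenvalues_def)
  then have "(\<lambda>n. (norm (poly (orth_poly a b n) z))\<^sup>2) \<longlonglongrightarrow> 0"
    by (rule summable_LIMSEQ_zero)
  from tendsto_real_sqrt[OF this] have u0: "(\<lambda>n. norm (u n z)) \<longlonglongrightarrow> 0"
    by (simp add: norm_poly)
  have "filterlim (\<lambda>n. norm (p n)) at_top sequentially"
    unfolding norm_wkb using assms by real_asymp
  then have "(\<lambda>n. inverse (norm (p n))) \<longlonglongrightarrow> 0" by (rule tendsto_inverse_0_at_top)
  from tendsto_mult[OF u0 this] have "(\<lambda>n. norm (u n z / p n)) \<longlonglongrightarrow> 0"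
    by (simp add: norm_mult norm_inverse divide_inverse)
  then have up: "(\<lambda>n. u n z / p n) \<longlonglongrightarrow> 0" by (rule tendsto_norm_zero_cancel)
  obtain C where C: "\<forall>\<^sub>F n in sequentially. norm (u n z / p n - lim (\<lambda>n. X n z)) \<le> C * real n powr (-\<rho>)"
    using dominant_asymptotics[OF assms, of "{z}"] by auto
  have "(\<lambda>n. real n powr (-\<rho>)) \<longlonglongrightarrow> 0" using rho_pos by real_asymp
  from tendsto_mult[OF tendsto_const this, of C] have "(\<lambda>n. C * real n powr (-\<rho>)) \<longlonglongrightarrow> 0" by simp
  then have "(\<lambda>n. u n z / p n - lim (\<lambda>n. X n z)) \<longlonglongrightarrow> 0"
    by (rule Lim_null_comparison[OF C])
  from tendsto_diff[OF up this] have "(\<lambda>n. lim (\<lambda>n. X n z)) \<longlonglongrightarrow> 0" by simp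
  then show "lim (\<lambda>n. X n z) = 0" by (simp add: LIMSEQ_const_iff)
qed

end

text \<open>The relative form for positive \<open>\<tau>\<close> is asserted off the zeros of
  \<open>\<kappa>\<close>: at a zero it would give P_n(z) = 0 for all positive n, and the recurrence
  would then give P_0 = 0. These zeros are identified as the eigenvalues, and the additive form with
  \<open>R\<close> covers the whole plane. Indices start at 1 because \<open>0 powr x\<close> is 0
  while P_0 = 1.\<close>

theorem theorem2p2:
  fixes a b :: "nat \<Rightarrow> real" and \<alpha> \<beta> \<gamma> \<sigma> \<nu> \<tau> \<rho> :: real
  assumes "\<And>n. a n > 0"
    and "(\<lambda>n. a n / real n powr \<sigma> - (1 + \<alpha> / real n)) \<in> O(\<lambda>n. 1 / real n ^ 2)"
    and "(\<lambda>n. b n / (2 * \<gamma> * real n powr \<sigma>) - (1 + \<beta> / real n)) \<in> O(\<lambda>n. 1 / real n ^ 2)"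
    and "\<bar>\<gamma>\<bar> = 1" and "\<sigma> > 3 / 2"
    and "\<nu> = - sgn \<gamma>" and "\<tau> = 2 * \<beta> - 2 * \<alpha> + \<sigma>" and "\<rho> = min (\<sigma> - 3 / 2) (1 / 2)"
  shows "(\<tau> < 0 \<longrightarrow>
      (\<exists>\<kappa>\<^sub>p \<kappa>\<^sub>m :: complex \<Rightarrow> complex. \<exists>R.
         (\<forall>z. \<forall>n\<ge>1. poly (orth_poly a b n) z =
            of_real (\<nu> ^ n * real n powr (- \<sigma> / 2 + 1 / 4)) *
            (\<kappa>\<^sub>p z * exp (- 2 * \<i> * of_real (sqrt (\<bar>\<tau>\<bar> * real n)))
             + \<kappa>\<^sub>m z * exp (2 * \<i> * of_real (sqrt (\<bar>\<tau>\<bar> * real n))) + R n z)) \<and>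
         bigo_unif_on_compacts UNIV R (\<lambda>n. real n powr (- \<rho>))))
    \<and> (\<tau> > 0 \<longrightarrow>
      (\<exists>\<kappa> :: complex \<Rightarrow> complex.
         (\<forall>z. \<kappa> z = 0 \<longleftrightarrow> z \<in> jacobi_eigenvalues a b) \<and>
         (\<exists>E. (\<forall>z. z \<notin> jacobi_eigenvalues a b \<longrightarrow> (\<forall>n\<ge>1. poly (orth_poly a b n) z =
                 \<kappa> z * of_real (\<nu> ^ n * real n powr (- \<sigma> / 2 + 1 / 4) * exp (2 * sqrt (\<tau> * real n))) *
                 (1 + E n z))) \<and>
              bigo_unif_on_compacts (- jacobi_eigenvalues a b) E (\<lambda>n. real n powr (- \<rho>))) \<and>
         (\<exists>R. (\<forall>z. \<forall>n\<ge>1. poly (orth_poly a b n) z =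
                 of_real (\<nu> ^ n * real n powr (- \<sigma> / 2 + 1 / 4) * exp (2 * sqrt (\<tau> * real n))) *
                 (\<kappa> z + R n z)) \<and>
              bigo_unif_on_compacts UNIV R (\<lambda>n. real n powr (- \<rho>)))))"
proof (intro conjI impI)
  {
    assume tau: "\<tau> < 0"
    \<comment> \<open>This sign of the root makes \<open>p\<close> carry the phase with -2i, so that
      the limit of \<open>X\<close> is the coefficient \<open>\<kappa>\<^sub>p\<close>.\<close>
    define k where "k = - \<i> * of_real (sqrt \<bar>\<tau>\<bar>)"
    have "k\<^sup>2 = of_real \<tau>"
      using tau by (simp add: k_def power_mult_distrib flip: of_real_power)
    then interpret jacobi_asymptotics a b \<alpha> \<beta> \<gamma> \<sigma> \<nu> \<rho> k
      using assms tau by unfold_locales (auto simp: k_def)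
    define \<kappa>\<^sub>p \<kappa>\<^sub>m where "\<kappa>\<^sub>p z = lim (\<lambda>n. X n z)" and "\<kappa>\<^sub>m z = lim (\<lambda>n. Y n z)" for z
    \<comment> \<open>The remainder is defined as the exact difference: the identity for positive n
      then holds by construction, and only its size needs proof.\<close>
    define R where "R n z = u n z / of_real (real n powr s) -
      (\<kappa>\<^sub>p z * exp (- 2 * \<i> * of_real (sqrt (\<bar>\<tau>\<bar> * real n)))
             + \<kappa>\<^sub>m z * exp (2 * \<i> * of_real (sqrt (\<bar>\<tau>\<bar> * real n))))" for n z
    have phase: "2 * k * of_real (sqrt (real n)) = - 2 * \<i> * of_real (sqrt (\<bar>\<tau>\<bar> * real n))"
      "- 2 * k * of_real (sqrt (real n)) = 2 * \<i> * of_real (sqrt (\<bar>\<tau>\<bar> * real n))" for n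
      by (simp_all add: k_def real_sqrt_mult)
    have "bigo_unif_on_compacts UNIV R (\<lambda>n. real n powr (- \<rho>))"
      unfolding bigo_unif_on_compacts_def R_def \<kappa>\<^sub>p_def \<kappa>\<^sub>m_def phase[symmetric]
      by (intro allI impI, elim conjE, rule oscillatory_asymptotics) (simp_all add: k_def)
    moreover have "poly (orth_poly a b n) z =
            of_real (\<nu> ^ n * real n powr (- \<sigma> / 2 + 1 / 4)) *
            (\<kappa>\<^sub>p z * exp (- 2 * \<i> * of_real (sqrt (\<bar>\<tau>\<bar> * real n)))
             + \<kappa>\<^sub>m z * exp (2 * \<i> * of_real (sqrt (\<bar>\<tau>\<bar> * real n))) + R n z)" if "n \<ge> 1" for n z
      using that unfolding poly_eq_u R_def s_def by simp
    ultimately show "\<exists>\<kappa>\<^sub>p \<kappa>\<^sub>m :: complex \<Rightarrow> complex. \<exists>R.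
         (\<forall>z. \<forall>n\<ge>1. poly (orth_poly a b n) z =
            of_real (\<nu> ^ n * real n powr (- \<sigma> / 2 + 1 / 4)) *
            (\<kappa>\<^sub>p z * exp (- 2 * \<i> * of_real (sqrt (\<bar>\<tau>\<bar> * real n)))
             + \<kappa>\<^sub>m z * exp (2 * \<i> * of_real (sqrt (\<bar>\<tau>\<bar> * real n))) + R n z)) \<and>
         bigo_unif_on_compacts UNIV R (\<lambda>n. real n powr (- \<rho>))"
      by blast
  }
  {
    assume tau: "\<tau> > 0"
    define k where "k = complex_of_real (sqrt \<tau>)"
    have "k\<^sup>2 = of_real \<tau>"
      using tau by (simp add: k_def flip: of_real_power)
    then interpret jacobi_asymptotics a b \<alpha> \<beta> \<gamma> \<sigma> \<nu> \<rho> k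
      using assms tau by unfold_locales (auto simp: k_def)
    have Re_k: "Re k > 0" using tau by (simp add: k_def)
    define \<kappa> where "\<kappa> z = lim (\<lambda>n. X n z)" for z
    define R where "R n z = u n z / p n - \<kappa> z" for n z
    have zero_iff: "\<kappa> z = 0 \<longleftrightarrow> z \<in> jacobi_eigenvalues a b" for z
      unfolding \<kappa>_def by (rule lim_X_eq_0_iff[OF Re_k])
    have R: "\<exists>C. \<forall>\<^sub>F n in sequentially. \<forall>z\<in>K. norm (R n z) \<le> C * real n powr (- \<rho>)" if "compact K" for K
      unfolding R_def \<kappa>_def by (rule dominant_asymptotics[OF Re_k that])
    have "exp (2 * k * of_real (sqrt (real n))) = of_real (exp (2 * sqrt (\<tau> * real n)))" for n
      by (simp add: k_def real_sqrt_mult mult_ac flip: exp_of_real)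
    then have scale: "of_real (\<nu> ^ n * real n powr (- \<sigma> / 2 + 1 / 4) * exp (2 * sqrt (\<tau> * real n))) =
        of_real (\<nu> ^ n) * p n" for n
      by (simp add: wkb_def s_def)
    have eq: "poly (orth_poly a b n) z =
        of_real (\<nu> ^ n * real n powr (- \<sigma> / 2 + 1 / 4) * exp (2 * sqrt (\<tau> * real n))) * (\<kappa> z + R n z)"
      if "n \<ge> 1" for n z
      using that wkb_nonzero[of n] unfolding poly_eq_u R_def scale by simp
    define F where "F n z = R n z / \<kappa> z" for n z
    have F: "bigo_unif_on_compacts (- jacobi_eigenvalues a b) F (\<lambda>n. real n powr (- \<rho>))"
      unfolding bigo_unif_on_compacts_def
    proof (intro allI impI, elim conjE)
      fix K assume K: "compact K" "K \<subseteq> - jacobi_eigenvalues a b"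
      \<comment> \<open>On \<open>K\<close> the continuous function \<open>\<kappa>\<close> has no
        zeros, so its reciprocal is bounded and the estimate of \<open>R\<close> passes to the
        relative error \<open>F\<close>.\<close>
      have "continuous_on K (\<lambda>z. inverse (\<kappa> z))"
        using K zero_iff unfolding \<kappa>_def
        by (intro continuous_on_inverse continuous_on_lim_X) auto
      then have "bounded ((\<lambda>z. inverse (\<kappa> z)) ` K)"
        using K(1) compact_continuous_image compact_imp_bounded by blast
      then obtain B where B: "\<And>z. z \<in> K \<Longrightarrow> norm (inverse (\<kappa> z)) \<le> B"
        by (auto simp: bounded_iff)
      obtain C where "\<forall>\<^sub>F n in sequentially. \<forall>z\<in>K. norm (R n z) \<le> C * real n powr (- \<rho>)"
        using R[OF K(1)] by blast
      then have "\<forall>\<^sub>F n in sequentially. \<forall>z\<in>K. norm (F n z) \<le> (C * B) * real n powr (- \<rho>)"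
      proof eventually_elim
        case (elim n)
        show ?case
        proof
          fix z assume z: "z \<in> K"
          have "norm (F n z) = norm (R n z) * norm (inverse (\<kappa> z))"
            by (simp add: F_def norm_mult norm_inverse divide_inverse)
          also have "\<dots> \<le> (C * real n powr (- \<rho>)) * B"
            using elim z by (intro mult_mono B) (auto intro: order.trans[OF norm_ge_zero])
          finally show "norm (F n z) \<le> (C * B) * real n powr (- \<rho>)" by (simp add: mult_ac)
        qed
      qed
      then show "\<exists>C. \<forall>\<^sub>F n in sequentially. \<forall>z\<in>K. norm (F n z) \<le> C * real n powr (- \<rho>)" by blast
    qed
    have eqF: "poly (orth_poly a b n) z =
        \<kappa> z * of_real (\<nu> ^ n * real n powr (- \<sigma> / 2 + 1 / 4) * exp (2 * sqrt (\<tau> * real n))) * (1 + F n z)"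
      if "z \<notin> jacobi_eigenvalues a b" "n \<ge> 1" for n z
    proof -
      have "\<kappa> z + R n z = \<kappa> z * (1 + F n z)"
        using that(1) zero_iff[of z] by (simp add: F_def field_simps)
      then show ?thesis unfolding eq[OF that(2)] by (simp only: mult_ac)
    qed
    have R': "bigo_unif_on_compacts UNIV R (\<lambda>n. real n powr (- \<rho>))"
      unfolding bigo_unif_on_compacts_def using R by blast
    show "\<exists>\<kappa> :: complex \<Rightarrow> complex.
         (\<forall>z. \<kappa> z = 0 \<longleftrightarrow> z \<in> jacobi_eigenvalues a b) \<and>
         (\<exists>E. (\<forall>z. z \<notin> jacobi_eigenvalues a b \<longrightarrow> (\<forall>n\<ge>1. poly (orth_poly a b n) z =
                 \<kappa> z * of_real (\<nu> ^ n * real n powr (- \<sigma> / 2 + 1 / 4) * exp (2 * sqrt (\<tau> * real n))) *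
                 (1 + E n z))) \<and>
              bigo_unif_on_compacts (- jacobi_eigenvalues a b) E (\<lambda>n. real n powr (- \<rho>))) \<and>
         (\<exists>R. (\<forall>z. \<forall>n\<ge>1. poly (orth_poly a b n) z =
                 of_real (\<nu> ^ n * real n powr (- \<sigma> / 2 + 1 / 4) * exp (2 * sqrt (\<tau> * real n))) *
                 (\<kappa> z + R n z)) \<and>
              bigo_unif_on_compacts UNIV R (\<lambda>n. real n powr (- \<rho>)))"
      by (intro exI[of _ \<kappa>] exI[of _ F] exI[of _ R] conjI allI impI zero_iff F R' eq eqF)
  }
qed

end
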